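(* Let $R_1^N(z)=\sum_j (z-\mu_j)_+$ be the first Riesz-mean of the eigenvalues $\mu_j$ (counted with multiplicity) of the Neumann Laplacian on the hemisphere $\mathbb{S}^2_+$. For all $z\geq 0$, $$ \frac14 z^2+\frac13 z\sqrt{z+\frac14}\leq R_1^N(z)\leq \frac14 z^2+\frac13 z\sqrt{z+\frac14}+z . $$ Moreover, equality in the lower bound occurs if and only if $z=l(l+1)$ for some $l\in\mathbb{N}=\{0,1,2,\dots\}$.
   Context: $\mathbb{S}^2_+=\mathbb{S}^2\cap\{x_3>0\}$ is the open hemisphere of the round unit sphere $\mathbb{S}^2\subset\mathbb{R}^3$. The distinct eigenvalues (energy levels) of the Neumann Laplacian $-\Delta$ on $\mathbb{S}^2_+$ are $\lambda_{(l)}=l(l+1)$, $l\in\mathbb{N}$, with multiplicity $l+1$; thus $R_1^N(z)=\sum_{l\ge0}(l+1)(z-l(l+1))_+$, where $a_+=\max(a,0)$. *)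

theory Defs
  imports "HOL-Analysis.Analysis" "HOL-Library.Function_Algebras"
begin

definition hemisphere :: "(real^3) set" where
  "hemisphere = {x. norm x = 1 \<and> x $ 3 > 0}"

definition equator :: "(real^3) set" where
  "equator = {x. norm x = 1 \<and> x $ 3 = 0}"

definition closed_hemisphere :: "(real^3) set" where
  "closed_hemisphere = hemisphere \<union> equator"

definition partial_deriv :: "3 \<Rightarrow> (real^3 \<Rightarrow> real) \<Rightarrow> real^3 \<Rightarrow> real" where
  "partial_deriv i f x = frechet_derivative f (at x) (axis i 1)"

text \<open>Meant for open sets only.\<close>

definition C2_on :: "(real^3) set \<Rightarrow> (real^3 \<Rightarrow> real) \<Rightarrow> bool" where
  "C2_on W f \<longleftrightarrow>
     f differentiable_on W \<and>
     (\<forall>i. partial_deriv i f differentiable_on W) \<and>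
     (\<forall>i j. continuous_on W (partial_deriv j (partial_deriv i f)))"

text \<open>Being \<open>C\<^sup>2\<close> up to the boundary means extending locally to a \<open>C\<^sup>2\<close> function
  of the ambient space.\<close>

definition C2_closed_hemisphere :: "(real^3 \<Rightarrow> real) \<Rightarrow> bool" where
  "C2_closed_hemisphere u \<longleftrightarrow>
     (\<exists>W F. open W \<and> closed_hemisphere \<subseteq> W \<and> C2_on W F \<and>
            (\<forall>x\<in>closed_hemisphere. F x = u x))"

text \<open>The Laplace--Beltrami operator of the round unit sphere at a point of the sphere: the
  Euclidean Laplacian of the extension of \<open>u\<close> that is constant along rays. In polar coordinates
  the Euclidean Laplacian is
  \<open>\<partial>\<^sub>r\<^sup>2 + (2/r) \<partial>\<^sub>r + r\<^sup>-\<^sup>2 \<Delta>\<close>,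
  and the radial terms vanish on such an extension.\<close>

definition sphere_laplacian :: "(real^3 \<Rightarrow> real) \<Rightarrow> real^3 \<Rightarrow> real" where
  "sphere_laplacian u x =
     (\<Sum>i\<in>UNIV. partial_deriv i (partial_deriv i (\<lambda>y. u (y /\<^sub>R norm y))) x)"

text \<open>The normal derivative at a point \<open>p\<close> of the equator is taken along the unit speed
  geodesic \<open>t \<mapsto> cos t p + sin t e\<^sub>3\<close>, which leaves \<open>p\<close> orthogonally to the equator
  into the hemisphere.\<close>

definition neumann_condition :: "(real^3 \<Rightarrow> real) \<Rightarrow> bool" where
  "neumann_condition u \<longleftrightarrow>
     (\<forall>p\<in>equator. ((\<lambda>t. u (cos t *\<^sub>R p + sin t *\<^sub>R axis 3 1)) has_real_derivative 0)
                   (at 0 within {0..}))"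

text \<open>Functions on the closed hemisphere are represented by functions on the ambient space that
  vanish off the closed hemisphere; this makes the representation unique, so that linear
  independence and dimension have their intended meaning.\<close>

definition neumann_eigenspace :: "real \<Rightarrow> (real^3 \<Rightarrow> real) set" where
  "neumann_eigenspace \<mu> =
     {u. (\<forall>x. x \<notin> closed_hemisphere \<longrightarrow> u x = 0) \<and>
         C2_closed_hemisphere u \<and>
         (\<forall>x\<in>hemisphere. - sphere_laplacian u x = \<mu> * u x) \<and>
         neumann_condition u}"

definition neumann_eigenvalues :: "real set" where
  "neumann_eigenvalues = {\<mu>. \<exists>u\<in>neumann_eigenspace \<mu>. u \<noteq> (\<lambda>x. 0)}"

definition fun_scale :: "real \<Rightarrow> (real^3 \<Rightarrow> real) \<Rightarrow> real^3 \<Rightarrow> real" where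
  "fun_scale c u = (\<lambda>x. c * u x)"

lemma vector_space_fun_scale: "vector_space fun_scale"
  by unfold_locales (auto simp: fun_scale_def fun_eq_iff algebra_simps)

definition neumann_multiplicity :: "real \<Rightarrow> nat" where
  "neumann_multiplicity \<mu> = vector_space.dim fun_scale (neumann_eigenspace \<mu>)"

text \<open>The sum over the eigenvalues counted with multiplicity, arranged as a sum over the distinct
  eigenvalues.\<close>

definition neumann_riesz_mean :: "real \<Rightarrow> real" where
  "neumann_riesz_mean z =
     (\<Sum>\<^sub>\<infinity>\<mu>\<in>neumann_eigenvalues. real (neumann_multiplicity \<mu>) * max (z - \<mu>) 0)"

end

theory Submission
  imports Defs
begin

text \<open>There are two independent parts: the Neumann spectrum consists of the numbers \<open>l (l + 1)\<close> with
multiplicity \<open>l + 1\<close> (\<open>neumann_eigenvalues_eq\<close>, \<open>neumann_multiplicity_eq\<close>), and the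
Riesz mean of that explicit sequence satisfies the bounds (\<open>riesz_sum_bounds\<close>).

For the spectrum, everything is extended to be constant along rays, so that the Laplace--Beltrami operator
becomes the Euclidean Laplacian. A point of the closed hemisphere is determined by its first two
coordinates, so the test functions are the angular monomials
\<open>m\<^sub>a\<^sub>b(x) = (x\<^sub>1/\<bar>x\<bar>)\<^sup>a (x\<^sub>2/\<bar>x\<bar>)\<^sup>b\<close>. They are even in \<open>x\<^sub>3\<close>, hence satisfy the
Neumann condition, and the Laplacian is triangular on them: with \<open>n = a + b\<close>,
\<open>\<bar>x\<bar>\<^sup>2 \<Delta> m\<^sub>a\<^sub>b = a (a - 1) m\<^sub>a\<^sub>-\<^sub>2\<^sub>,\<^sub>b + b (b - 1) m\<^sub>a\<^sub>,\<^sub>b\<^sub>-\<^sub>2 - n (n + 1) m\<^sub>a\<^sub>b\<close>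
(\<open>laplacian_angular_monomial\<close>).

Upper bound for the spectrum. Integrate over the part of a shell in the upper half-space, with a radial cutoff.
The cutoff contributes nothing to Green's identity because all gradients are orthogonal to the radius, and
the flat boundary contributes nothing by the Neumann condition (\<open>green_half_box\<close>). Only the
fundamental theorem of calculus in each coordinate and Fubini's theorem on a box are involved, no surface integral. For an
eigenfunction with eigenvalue \<open>\<mu>\<close> and moments \<open>M\<^sub>a\<^sub>b\<close> against \<open>m\<^sub>a\<^sub>b\<close> this gives
\<open>(n (n + 1) - \<mu>) M\<^sub>a\<^sub>b = a (a - 1) M\<^sub>a\<^sub>-\<^sub>2\<^sub>,\<^sub>b + b (b - 1) M\<^sub>a\<^sub>,\<^sub>b\<^sub>-\<^sub>2\<close>.
If \<open>\<mu>\<close> is not of the form \<open>l (l + 1)\<close>, then all moments vanish by induction on \<open>n\<close>; if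
\<open>\<mu> = l (l + 1)\<close>, then the \<open>l + 1\<close> moments with \<open>a + b = l\<close> determine all others. A function whose
moments all vanish is zero by the Stone--Weierstrass theorem (\<open>moments_determine\<close>). So there are no
other eigenvalues, and each multiplicity is at most \<open>l + 1\<close>.

Lower bound for the multiplicity. Since \<open>n (n + 1) \<noteq> l (l + 1)\<close> for \<open>n < l\<close>, the triangular
system can be solved below degree \<open>l\<close>, so every \<open>m\<^sub>a\<^sub>b\<close> with \<open>a + b = l\<close> is the leading part of
an eigenfunction (\<open>harmonic_with_leading_monomial\<close>). Distinct leading monomials make these
\<open>l + 1\<close> eigenfunctions independent (\<open>homogeneous_part_unique\<close>).

For the Riesz mean write \<open>sqrt (z + 1/4) = L + 1/2 + t\<close> with a natural number \<open>L\<close> and \<open>0 \<le> t < 1\<close>. Then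
\<open>L\<close> is the index of the last eigenvalue not exceeding \<open>z\<close>, and the difference between the Riesz mean
and the lower bound is the polynomial
\<open>t (1 - t) ((L + 1) (L + 1 + t) + t\<^sup>2/4 + t/12 - 1/6)\<close>, which is at least 0, at most \<open>z\<close>, and zero
only for \<open>t = 0\<close>, that is for \<open>z = L (L + 1)\<close>.\<close>

section \<open>Continuously differentiable functions on open sets of space\<close>

lemma power2_norm_vec3: "(norm x)\<^sup>2 = (x $ 1)\<^sup>2 + (x $ 2)\<^sup>2 + (x $ 3)\<^sup>2" for x :: "real^3"
  unfolding power2_norm_eq_inner by (simp add: inner_vec_def sum_3 power2_eq_square)

text \<open>A function is \<open>C2_on\<close> an open set iff it is differentiable with partial derivatives in this class. Closure
properties of \<open>C2_on\<close> therefore reduce to those of \<open>C1_on\<close>.\<close>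

definition C1_on :: "(real^3) set \<Rightarrow> (real^3 \<Rightarrow> real) \<Rightarrow> bool" where
  "C1_on W f \<longleftrightarrow> f differentiable_on W \<and> (\<forall>i. continuous_on W (partial_deriv i f))"

lemma C2_on_iff_C1_on:
  "C2_on W f \<longleftrightarrow> f differentiable_on W \<and> (\<forall>i. C1_on W (partial_deriv i f))"
  unfolding C2_on_def C1_on_def by auto

lemma partial_deriv_eq: "(f has_derivative D) (at x) \<Longrightarrow> partial_deriv i f x = D (axis i 1)"
  unfolding partial_deriv_def by (metis frechet_derivative_at)

lemma has_derivative_partial_derivs:
  assumes "f differentiable (at x)"
  shows "(f has_derivative (\<lambda>h. \<Sum>i\<in>UNIV. partial_deriv i f x * h $ i)) (at x)"
proof -
  obtain D where D: "(f has_derivative D) (at x)" using assms by (auto simp: differentiable_def)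
  interpret linear D using D by (rule has_derivative_linear)
  have "D h = (\<Sum>i\<in>UNIV. partial_deriv i f x * h $ i)" for h
  proof -
    have "D h = D (\<Sum>i\<in>UNIV. h $ i *\<^sub>R axis i 1)"
      by (simp add: basis_expansion[of h, unfolded scalar_mult_eq_scaleR])
    also have "\<dots> = (\<Sum>i\<in>UNIV. h $ i * D (axis i 1))" by (simp add: sum scale)
    finally show ?thesis by (simp add: partial_deriv_eq[OF D] mult.commute)
  qed
  then show ?thesis using D by (metis (no_types, lifting) ext)
qed

lemma partial_deriv_cong_open:
  assumes "open W" "x \<in> W" "\<And>y. y \<in> W \<Longrightarrow> f y = g y"
  shows "partial_deriv i f x = partial_deriv i g x"
proof -
  have "(f has_derivative D) (at x) \<longleftrightarrow> (g has_derivative D) (at x)" for D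
    using assms has_derivative_transform_within_open[of f D x UNIV W g]
      has_derivative_transform_within_open[of g D x UNIV W f] by auto
  then show ?thesis unfolding partial_deriv_def frechet_derivative_def by presburger
qed

lemma differentiable_on_cong_open:
  assumes "open W" "\<And>y. y \<in> W \<Longrightarrow> f y = g y"
  shows "f differentiable_on W \<longleftrightarrow> g differentiable_on W"
  using assms unfolding differentiable_on_def differentiable_def
  by (metis has_derivative_transform)

lemma C1_on_cong:
  assumes "open W" "\<And>y. y \<in> W \<Longrightarrow> f y = g y"
  shows "C1_on W f \<longleftrightarrow> C1_on W g"
proof -
  have p: "partial_deriv i f x = partial_deriv i g x" if "x \<in> W" for i x
    using partial_deriv_cong_open[OF assms(1) that assms(2)] .
  have "continuous_on W (partial_deriv i f) \<longleftrightarrow> continuous_on W (partial_deriv i g)" for i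
    using p by (intro continuous_on_cong) auto
  then show ?thesis unfolding C1_on_def using differentiable_on_cong_open[OF assms] by auto
qed

lemma C2_on_imp_C1_on: "C2_on W f \<Longrightarrow> C1_on W f"
  unfolding C2_on_def C1_on_def by (auto intro: differentiable_imp_continuous_on)

lemma C1_on_subset: "C1_on W f \<Longrightarrow> V \<subseteq> W \<Longrightarrow> C1_on V f"
  unfolding C1_on_def by (meson continuous_on_subset differentiable_on_subset)

lemma C2_on_subset: "C2_on W f \<Longrightarrow> V \<subseteq> W \<Longrightarrow> C2_on V f"
  unfolding C2_on_iff_C1_on by (meson C1_on_subset differentiable_on_subset)

lemma differentiable_on_open_at: "f differentiable_on W \<Longrightarrow> open W \<Longrightarrow> x \<in> W \<Longrightarrow> f differentiable (at x)"
  by (simp add: differentiable_on_eq_differentiable_at)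

lemma C1_on_has_derivative:
  assumes "open W" "C1_on W f" "x \<in> W"
  shows "(f has_derivative (\<lambda>h. \<Sum>i\<in>UNIV. partial_deriv i f x * h $ i)) (at x)"
  using assms by (auto intro: has_derivative_partial_derivs differentiable_on_open_at simp: C1_on_def)

text \<open>Exhibiting a continuous gradient gives membership and the values of the partial derivatives at once; the closure
properties below all come in such pairs.\<close>

lemma C1_onI:
  assumes "open W" "\<And>x. x \<in> W \<Longrightarrow> (f has_derivative (\<lambda>h. \<Sum>i\<in>UNIV. g i x * h $ i)) (at x)"
    "\<And>i. continuous_on W (g i)"
  shows "C1_on W f" "x \<in> W \<Longrightarrow> partial_deriv i f x = g i x"
proof -
  show p: "partial_deriv i f x = g i x" if "x \<in> W" for x i
    using partial_deriv_eq[OF assms(2)[OF that], of i] by (simp add: axis_def if_distrib cong: if_cong)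
  show "C1_on W f" unfolding C1_on_def
    using assms p by (auto simp: differentiable_on_eq_differentiable_at differentiable_def cong: continuous_on_cong)
qed

lemma C1_on_continuous: "C1_on W f \<Longrightarrow> continuous_on W f"
  unfolding C1_on_def by (auto intro: differentiable_imp_continuous_on)

lemma C1_on_continuous_partial: "C1_on W f \<Longrightarrow> continuous_on W (partial_deriv i f)"
  unfolding C1_on_def by auto

lemma
  assumes "open W" "C1_on W f" "C1_on W g"
  shows C1_on_add: "C1_on W (\<lambda>x. f x + g x)"
    and partial_deriv_add: "x \<in> W \<Longrightarrow> partial_deriv i (\<lambda>x. f x + g x) x = partial_deriv i f x + partial_deriv i g x"
    and C1_on_mult: "C1_on W (\<lambda>x. f x * g x)"
    and partial_deriv_mult: "x \<in> W \<Longrightarrow> partial_deriv i (\<lambda>x. f x * g x) x = partial_deriv i f x * g x + f x * partial_deriv i g x"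
proof -
  note d = C1_on_has_derivative[OF assms(1,2)] C1_on_has_derivative[OF assms(1,3)]
  note c [continuous_intros] = assms(2,3)[THEN C1_on_continuous] assms(2,3)[THEN C1_on_continuous_partial]
  have 1: "((\<lambda>x. f x + g x) has_derivative (\<lambda>h. \<Sum>i\<in>UNIV. (partial_deriv i f x + partial_deriv i g x) * h $ i)) (at x)"
    if "x \<in> W" for x
    by (rule has_derivative_eq_rhs, (rule derivative_intros d that)+) (simp add: sum.distrib algebra_simps)
  have 2: "((\<lambda>x. f x * g x) has_derivative (\<lambda>h. \<Sum>i\<in>UNIV. (partial_deriv i f x * g x + f x * partial_deriv i g x) * h $ i)) (at x)"
    if "x \<in> W" for x
    by (rule has_derivative_eq_rhs, (rule derivative_intros d that)+) (simp add: sum.distrib algebra_simps sum_distrib_left)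
  show "C1_on W (\<lambda>x. f x + g x)" "x \<in> W \<Longrightarrow> partial_deriv i (\<lambda>x. f x + g x) x = partial_deriv i f x + partial_deriv i g x"
    by (rule C1_onI[OF assms(1) 1]; (assumption | intro continuous_intros))+
  show "C1_on W (\<lambda>x. f x * g x)" "x \<in> W \<Longrightarrow> partial_deriv i (\<lambda>x. f x * g x) x = partial_deriv i f x * g x + f x * partial_deriv i g x"
    by (rule C1_onI[OF assms(1) 2]; (assumption | intro continuous_intros))+
qed

lemma
  assumes "open W"
  shows C1_on_const: "C1_on W (\<lambda>x. c)"
    and partial_deriv_const: "x \<in> W \<Longrightarrow> partial_deriv i (\<lambda>x. c) x = 0"
  by (rule C1_onI[where g="\<lambda>_ _. 0", OF assms]; simp)+

lemma
  assumes "open W"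
  shows C1_on_component: "C1_on W (\<lambda>x. x $ j)"
    and partial_deriv_component: "x \<in> W \<Longrightarrow> partial_deriv i (\<lambda>x. x $ j) x = (if i = j then 1 else 0)"
proof -
  have "((\<lambda>x. x $ j) has_derivative (\<lambda>h. \<Sum>i\<in>UNIV. (if i = j then 1 else 0) * h $ i)) (at x)" for x :: "real^3"
    using bounded_linear_imp_has_derivative[OF bounded_linear_vec_nth[of j]] exhaust_3[of j] by (auto simp: sum_3)
  then show "C1_on W (\<lambda>x. x $ j)" "x \<in> W \<Longrightarrow> partial_deriv i (\<lambda>x. x $ j) x = (if i = j then 1 else 0)"
    by (rule C1_onI[where g="\<lambda>i _. if i = j then 1 else 0", OF assms]; simp)+
qed

lemma
  assumes "open W" "0 \<notin> W"
  shows C1_on_inverse_norm: "C1_on W (\<lambda>x. inverse (norm x))"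
    and partial_deriv_inverse_norm: "x \<in> W \<Longrightarrow> partial_deriv i (\<lambda>x. inverse (norm x)) x = - (x $ i * inverse (norm x) ^ 3)"
proof -
  have d: "((\<lambda>x. inverse (norm x)) has_derivative (\<lambda>h. \<Sum>i\<in>UNIV. (- (x $ i * inverse (norm x) ^ 3)) * h $ i)) (at x)"
    if "x \<in> W" for x :: "real^3"
  proof -
    have "x \<noteq> 0" using that assms by auto
    then show ?thesis
      by (auto intro!: derivative_eq_intros has_derivative_norm simp: fun_eq_iff sgn_div_norm inner_vec_def sum_distrib_left sum_distrib_right field_simps power3_eq_cube simp flip: sum_negf sum_divide_distrib)
  qed
  have c: "continuous_on W (\<lambda>x. - (x $ i * inverse (norm x) ^ 3))" for i
    using assms by (intro continuous_intros) auto
  show "C1_on W (\<lambda>x. inverse (norm x))" "x \<in> W \<Longrightarrow> partial_deriv i (\<lambda>x. inverse (norm x)) x = - (x $ i * inverse (norm x) ^ 3)"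
    by (rule C1_onI[OF assms(1) d c]; assumption)+
qed

lemma C1_on_sum:
  assumes "open W" "\<And>j. j \<in> J \<Longrightarrow> C1_on W (f j)"
  shows "C1_on W (\<lambda>x. \<Sum>j\<in>J. f j x)"
  using assms(2) by (induction J rule: infinite_finite_induct) (auto intro!: C1_on_add C1_on_const assms(1))

lemma C1_on_power: "open W \<Longrightarrow> C1_on W f \<Longrightarrow> C1_on W (\<lambda>x. f x ^ n)"
  by (induction n) (auto intro: C1_on_const C1_on_mult)

lemma
  fixes \<nu> :: "real^3 \<Rightarrow> real^3"
  assumes "open W" "open V" "C1_on V f" "\<And>j. C1_on W (\<lambda>x. \<nu> x $ j)" "\<nu> ` W \<subseteq> V"
  shows C1_on_compose: "C1_on W (\<lambda>x. f (\<nu> x))"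
    and partial_deriv_compose: "x \<in> W \<Longrightarrow> partial_deriv i (\<lambda>x. f (\<nu> x)) x
      = (\<Sum>j\<in>UNIV. partial_deriv j f (\<nu> x) * partial_deriv i (\<lambda>x. \<nu> x $ j) x)"
proof -
  have dv: "(\<nu> has_derivative (\<lambda>h. \<chi> j. \<Sum>i\<in>UNIV. partial_deriv i (\<lambda>x. \<nu> x $ j) x * h $ i)) (at x)" if "x \<in> W" for x
    by (subst has_derivative_componentwise_within)
       (auto simp: Basis_vec_def inner_axis C1_on_has_derivative[OF assms(1) assms(4) that])
  have d: "((\<lambda>x. f (\<nu> x)) has_derivative (\<lambda>h. \<Sum>i\<in>UNIV. (\<Sum>j\<in>UNIV. partial_deriv j f (\<nu> x) * partial_deriv i (\<lambda>x. \<nu> x $ j) x) * h $ i)) (at x)"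
    if "x \<in> W" for x
  proof -
    have "\<nu> x \<in> V" using that assms by auto
    from has_derivative_compose[OF dv[OF that] C1_on_has_derivative[OF assms(2,3) this]]
    show ?thesis
      by (rule has_derivative_eq_rhs)
        (simp add: fun_eq_iff sum_3 algebra_simps)
  qed
  have cv: "continuous_on W \<nu>"
    using dv by (meson assms(1) continuous_at_imp_continuous_on has_derivative_continuous)
  have c: "continuous_on W (\<lambda>x. \<Sum>j\<in>UNIV. partial_deriv j f (\<nu> x) * partial_deriv i (\<lambda>x. \<nu> x $ j) x)" for i
    by (intro continuous_intros C1_on_continuous_partial[OF assms(4)]
         continuous_on_compose2[OF C1_on_continuous_partial[OF assms(3)] cv] assms(5))
  show "C1_on W (\<lambda>x. f (\<nu> x))" "x \<in> W \<Longrightarrow> partial_deriv i (\<lambda>x. f (\<nu> x)) x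
      = (\<Sum>j\<in>UNIV. partial_deriv j f (\<nu> x) * partial_deriv i (\<lambda>x. \<nu> x $ j) x)"
    by (rule C1_onI[OF assms(1) d c]; assumption)+
qed

lemma C2_onI:
  assumes "open W" "C1_on W f" "\<And>i x. x \<in> W \<Longrightarrow> partial_deriv i f x = g i x" "\<And>i. C1_on W (g i)"
  shows "C2_on W f"
  unfolding C2_on_iff_C1_on using assms C1_on_cong[OF assms(1) assms(3)] by (auto simp: C1_on_def)

lemma C2_on_C1_on_partial: "C2_on W f \<Longrightarrow> C1_on W (partial_deriv i f)"
  unfolding C2_on_iff_C1_on by auto

lemma C2_on_add: "open W \<Longrightarrow> C2_on W f \<Longrightarrow> C2_on W g \<Longrightarrow> C2_on W (\<lambda>x. f x + g x)"
  by (rule C2_onI[where g="\<lambda>i x. partial_deriv i f x + partial_deriv i g x"])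
    (auto intro!: C1_on_add partial_deriv_add dest: C2_on_imp_C1_on C2_on_C1_on_partial)

lemma C2_on_mult: "open W \<Longrightarrow> C2_on W f \<Longrightarrow> C2_on W g \<Longrightarrow> C2_on W (\<lambda>x. f x * g x)"
  by (rule C2_onI[where g="\<lambda>i x. partial_deriv i f x * g x + f x * partial_deriv i g x"])
    (auto intro!: C1_on_add C1_on_mult partial_deriv_mult dest: C2_on_imp_C1_on C2_on_C1_on_partial)

lemma C2_on_const: "open W \<Longrightarrow> C2_on W (\<lambda>x. c)"
  by (rule C2_onI[where g="\<lambda>i x. 0"]) (auto intro!: C1_on_const partial_deriv_const)

lemma C2_on_component: "open W \<Longrightarrow> C2_on W (\<lambda>x. x $ j)"
  by (rule C2_onI[where g="\<lambda>i x. if i = j then 1 else 0"]) (auto intro: C1_on_const C1_on_component simp: partial_deriv_component)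

lemma C2_on_power: "open W \<Longrightarrow> C2_on W f \<Longrightarrow> C2_on W (\<lambda>x. f x ^ n)"
  by (induction n) (auto intro: C2_on_const C2_on_mult)

lemma C2_on_inverse_norm:
  assumes "open W" "0 \<notin> W" shows "C2_on W (\<lambda>x. inverse (norm x))"
proof (rule C2_onI[where g="\<lambda>i x. (-1) * (x $ i * inverse (norm x) ^ 3)"])
  show "C1_on W (\<lambda>x. (-1) * (x $ i * inverse (norm x) ^ 3))" for i
    by (intro C1_on_const C1_on_mult C1_on_component C1_on_power C1_on_inverse_norm assms)
qed (use assms partial_deriv_inverse_norm[OF assms] C1_on_inverse_norm[OF assms] in auto)

text \<open>By the chain rule the first derivatives of the composition are again built from \<open>C1_on\<close> functions by
composition, products and sums. The case of interest is the radial projection to the unit sphere.\<close>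

lemma C2_on_compose:
  fixes \<nu> :: "real^3 \<Rightarrow> real^3"
  assumes "open W" "open V" "C2_on V f" "\<And>j. C2_on W (\<lambda>x. \<nu> x $ j)" "\<nu> ` W \<subseteq> V"
  shows "C2_on W (\<lambda>x. f (\<nu> x))"
proof (rule C2_onI[OF assms(1)])
  note n1 = C2_on_imp_C1_on[OF assms(4)]
  show "C1_on W (\<lambda>x. f (\<nu> x))"
    by (rule C1_on_compose[OF assms(1,2) C2_on_imp_C1_on[OF assms(3)] n1 assms(5)])
  show "x \<in> W \<Longrightarrow> partial_deriv i (\<lambda>x. f (\<nu> x)) x
      = (\<Sum>j\<in>UNIV. partial_deriv j f (\<nu> x) * partial_deriv i (\<lambda>x. \<nu> x $ j) x)" for i x
    by (rule partial_deriv_compose[OF assms(1,2) C2_on_imp_C1_on[OF assms(3)] n1 assms(5)])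
  show "C1_on W (\<lambda>x. \<Sum>j\<in>UNIV. partial_deriv j f (\<nu> x) * partial_deriv i (\<lambda>x. \<nu> x $ j) x)" for i
    by (intro C1_on_sum C1_on_mult assms(1) C2_on_C1_on_partial[OF assms(4)]
       C1_on_compose[OF assms(1,2) C2_on_C1_on_partial[OF assms(3)] n1 assms(5)])
qed

section \<open>The Laplacian of angular monomials\<close>

definition laplacian :: "(real^3 \<Rightarrow> real) \<Rightarrow> real^3 \<Rightarrow> real" where
  "laplacian f x = (\<Sum>i\<in>UNIV. partial_deriv i (partial_deriv i f) x)"

lemma laplacian_cong_open:
  assumes "open W" "x \<in> W" "\<And>y. y \<in> W \<Longrightarrow> f y = g y"
  shows "laplacian f x = laplacian g x"
  unfolding laplacian_def by (intro sum.cong refl partial_deriv_cong_open[OF assms(1)] assms)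

lemma partial_deriv_lincomb:
  assumes "open W" "C1_on W f" "C1_on W g" "x \<in> W"
  shows "partial_deriv i (\<lambda>x. c * f x + d * g x) x = c * partial_deriv i f x + d * partial_deriv i g x"
  using assms by (simp add: partial_deriv_add partial_deriv_mult C1_on_const C1_on_mult partial_deriv_const)

lemma laplacian_lincomb:
  assumes "open W" "C2_on W f" "C2_on W g" "x \<in> W"
  shows "laplacian (\<lambda>x. c * f x + d * g x) x = c * laplacian f x + d * laplacian g x"
proof -
  have "partial_deriv i (partial_deriv i (\<lambda>x. c * f x + d * g x)) x =
      c * partial_deriv i (partial_deriv i f) x + d * partial_deriv i (partial_deriv i g) x" for i
  proof -
    have "partial_deriv i (partial_deriv i (\<lambda>x. c * f x + d * g x)) x
        = partial_deriv i (\<lambda>x. c * partial_deriv i f x + d * partial_deriv i g x) x"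
      using assms by (intro partial_deriv_cong_open[of W] partial_deriv_lincomb[of W]) (auto intro: C2_on_imp_C1_on)
    also have "\<dots> = c * partial_deriv i (partial_deriv i f) x + d * partial_deriv i (partial_deriv i g) x"
      using assms by (intro partial_deriv_lincomb[of W]) (auto intro: C2_on_C1_on_partial)
    finally show ?thesis .
  qed
  then show ?thesis unfolding laplacian_def by (simp add: sum.distrib sum_distrib_left)
qed

text \<open>Partial differentiation leads out of the span of the angular monomials, but not out of the span of all these functions.
Second derivatives are therefore computed in this larger family.\<close>

definition scaled_monomial :: "nat \<Rightarrow> nat \<Rightarrow> nat \<Rightarrow> nat \<Rightarrow> real^3 \<Rightarrow> real" where
  "scaled_monomial a b c m x = x $ 1 ^ a * x $ 2 ^ b * x $ 3 ^ c * inverse (norm x) ^ m"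

lemma C2_on_scaled_monomial: "C2_on (- {0}) (scaled_monomial a b c m)"
  unfolding scaled_monomial_def[abs_def]
  by (intro C2_on_mult C2_on_power C2_on_component C2_on_inverse_norm) auto

lemma partial_deriv_scaled_monomial:
  assumes "x \<noteq> 0"
  shows "partial_deriv 1 (scaled_monomial a b c m) x = real a * scaled_monomial (a - 1) b c m x + (- real m) * scaled_monomial (Suc a) b c (m + 2) x"
    and "partial_deriv 2 (scaled_monomial a b c m) x = real b * scaled_monomial a (b - 1) c m x + (- real m) * scaled_monomial a (Suc b) c (m + 2) x"
    and "partial_deriv 3 (scaled_monomial a b c m) x = real c * scaled_monomial a b (c - 1) m x + (- real m) * scaled_monomial a b (Suc c) (m + 2) x"
proof -
  define \<rho> where "\<rho> = inverse (norm x)"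
  have o: "open (- {0} :: (real^3) set)" by auto
  have i: "((\<lambda>x. inverse (norm x)) has_derivative (\<lambda>h. - (\<rho> ^ 3) * (x $ 1 * h $ 1 + x $ 2 * h $ 2 + x $ 3 * h $ 3))) (at x)"
    using C1_on_has_derivative[OF o C1_on_inverse_norm[OF o], of x] assms
    by (simp add: sum_3 partial_deriv_inverse_norm[OF o] \<rho>_def algebra_simps)
  have n: "((\<lambda>x. x $ j) has_derivative (\<lambda>h. h $ j)) (at x)" for j
    by (rule bounded_linear_imp_has_derivative[OF bounded_linear_vec_nth])
  have D: "(scaled_monomial a b c m has_derivative (\<lambda>h.
       real a * x $ 1 ^ (a - 1) * h $ 1 * x $ 2 ^ b * x $ 3 ^ c * \<rho> ^ m
     + real b * x $ 2 ^ (b - 1) * h $ 2 * x $ 1 ^ a * x $ 3 ^ c * \<rho> ^ m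
     + real c * x $ 3 ^ (c - 1) * h $ 3 * x $ 1 ^ a * x $ 2 ^ b * \<rho> ^ m
     - real m * \<rho> ^ (m - 1) * \<rho> ^ 3 * (x $ 1 * h $ 1 + x $ 2 * h $ 2 + x $ 3 * h $ 3) * x $ 1 ^ a * x $ 2 ^ b * x $ 3 ^ c)) (at x)"
    unfolding scaled_monomial_def[abs_def]
    by (rule has_derivative_eq_rhs, (rule has_derivative_mult has_derivative_power n i)+)
       (simp add: fun_eq_iff algebra_simps flip: \<rho>_def)
  have m: "real m * \<rho> ^ (m - 1) * \<rho> ^ 3 = real m * \<rho> ^ (m + 2)"
    by (cases m) (auto simp: power_add power3_eq_cube power2_eq_square)
  note D' = D[unfolded m]
  have ax: "axis i (1::real) $ j = (if j = i then 1 else 0)" for i j :: 3 by (auto simp: axis_def)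
  show "partial_deriv 1 (scaled_monomial a b c m) x = real a * scaled_monomial (a - 1) b c m x + (- real m) * scaled_monomial (Suc a) b c (m + 2) x"
    "partial_deriv 2 (scaled_monomial a b c m) x = real b * scaled_monomial a (b - 1) c m x + (- real m) * scaled_monomial a (Suc b) c (m + 2) x"
    "partial_deriv 3 (scaled_monomial a b c m) x = real c * scaled_monomial a b (c - 1) m x + (- real m) * scaled_monomial a b (Suc c) (m + 2) x"
    unfolding partial_deriv_eq[OF D'] ax scaled_monomial_def \<rho>_def[symmetric] by (simp_all add: algebra_simps)
qed

lemma partial_deriv2_scaled_monomial:
  assumes x: "x \<noteq> 0"
  shows "partial_deriv 1 (partial_deriv 1 (scaled_monomial a b c m)) x =
      real a * (real a - 1) * scaled_monomial (a - 2) b c m x - real m * (2 * real a + 1) * scaled_monomial a b c (m + 2) x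
      + real m * (real m + 2) * scaled_monomial (a + 2) b c (m + 4) x"
    and "partial_deriv 2 (partial_deriv 2 (scaled_monomial a b c m)) x =
      real b * (real b - 1) * scaled_monomial a (b - 2) c m x - real m * (2 * real b + 1) * scaled_monomial a b c (m + 2) x
      + real m * (real m + 2) * scaled_monomial a (b + 2) c (m + 4) x"
    and "partial_deriv 3 (partial_deriv 3 (scaled_monomial a b c m)) x =
      real c * (real c - 1) * scaled_monomial a b (c - 2) m x - real m * (2 * real c + 1) * scaled_monomial a b c (m + 2) x
      + real m * (real m + 2) * scaled_monomial a b (c + 2) (m + 4) x"
proof -
  have o: "open (- {0} :: (real^3) set)" by auto
  note l = partial_deriv_lincomb[OF o C2_on_imp_C1_on[OF C2_on_scaled_monomial] C2_on_imp_C1_on[OF C2_on_scaled_monomial]]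
  have "partial_deriv 1 (partial_deriv 1 (scaled_monomial a b c m)) x = partial_deriv 1
     (\<lambda>x. real a * scaled_monomial (a - 1) b c m x + (- real m) * scaled_monomial (Suc a) b c (m + 2) x) x"
    by (rule partial_deriv_cong_open[OF o]) (use x partial_deriv_scaled_monomial in auto)
  also have "\<dots> = real a * (real a - 1) * scaled_monomial (a - 2) b c m x - real m * (2 * real a + 1) * scaled_monomial a b c (m + 2) x
      + real m * (real m + 2) * scaled_monomial (a + 2) b c (m + 4) x"
    using x by (subst l, simp) (cases a; simp add: partial_deriv_scaled_monomial algebra_simps flip: Suc_eq_plus1; simp add: numeral_eq_Suc)
  finally show "partial_deriv 1 (partial_deriv 1 (scaled_monomial a b c m)) x =
      real a * (real a - 1) * scaled_monomial (a - 2) b c m x - real m * (2 * real a + 1) * scaled_monomial a b c (m + 2) x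
      + real m * (real m + 2) * scaled_monomial (a + 2) b c (m + 4) x" .
  have "partial_deriv 2 (partial_deriv 2 (scaled_monomial a b c m)) x = partial_deriv 2
     (\<lambda>x. real b * scaled_monomial a (b - 1) c m x + (- real m) * scaled_monomial a (Suc b) c (m + 2) x) x"
    by (rule partial_deriv_cong_open[OF o]) (use x partial_deriv_scaled_monomial in auto)
  also have "\<dots> = real b * (real b - 1) * scaled_monomial a (b - 2) c m x - real m * (2 * real b + 1) * scaled_monomial a b c (m + 2) x
      + real m * (real m + 2) * scaled_monomial a (b + 2) c (m + 4) x"
    using x by (subst l, simp) (cases b; simp add: partial_deriv_scaled_monomial algebra_simps flip: Suc_eq_plus1; simp add: numeral_eq_Suc)
  finally show "partial_deriv 2 (partial_deriv 2 (scaled_monomial a b c m)) x =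
      real b * (real b - 1) * scaled_monomial a (b - 2) c m x - real m * (2 * real b + 1) * scaled_monomial a b c (m + 2) x
      + real m * (real m + 2) * scaled_monomial a (b + 2) c (m + 4) x" .
  have "partial_deriv 3 (partial_deriv 3 (scaled_monomial a b c m)) x = partial_deriv 3
     (\<lambda>x. real c * scaled_monomial a b (c - 1) m x + (- real m) * scaled_monomial a b (Suc c) (m + 2) x) x"
    by (rule partial_deriv_cong_open[OF o]) (use x partial_deriv_scaled_monomial in auto)
  also have "\<dots> = real c * (real c - 1) * scaled_monomial a b (c - 2) m x - real m * (2 * real c + 1) * scaled_monomial a b c (m + 2) x
      + real m * (real m + 2) * scaled_monomial a b (c + 2) (m + 4) x"
    using x by (subst l, simp) (cases c; simp add: partial_deriv_scaled_monomial algebra_simps flip: Suc_eq_plus1; simp add: numeral_eq_Suc)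
  finally show "partial_deriv 3 (partial_deriv 3 (scaled_monomial a b c m)) x =
      real c * (real c - 1) * scaled_monomial a b (c - 2) m x - real m * (2 * real c + 1) * scaled_monomial a b c (m + 2) x
      + real m * (real m + 2) * scaled_monomial a b (c + 2) (m + 4) x" .
qed

definition angular_monomial :: "nat \<Rightarrow> nat \<Rightarrow> real^3 \<Rightarrow> real" where
  "angular_monomial a b x = (x $ 1 / norm x) ^ a * (x $ 2 / norm x) ^ b"

lemma angular_monomial_eq_scaled_monomial: "angular_monomial a b = scaled_monomial a b 0 (a + b)"
  by (auto simp: angular_monomial_def scaled_monomial_def fun_eq_iff power_add divide_inverse power_mult_distrib)

lemma C2_on_angular_monomial: "C2_on (- {0}) (angular_monomial a b)"
  unfolding angular_monomial_eq_scaled_monomial by (rule C2_on_scaled_monomial)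

text \<open>The monomial \<open>p = x\<^sub>1\<^sup>a x\<^sub>2\<^sup>b\<close> of degree \<open>n\<close> satisfies
\<open>\<Delta> (\<bar>x\<bar>\<^sup>-\<^sup>n p) = \<bar>x\<bar>\<^sup>-\<^sup>n \<Delta> p - n (n + 1) \<bar>x\<bar>\<^sup>-\<^sup>n\<^sup>-\<^sup>2 p\<close>, since the powers of the norm
contribute \<open>n (n + 2)\<close> and \<open>- n (2 n + 3)\<close>. So the spherical Laplacian is diagonal up to terms of degree
\<open>n - 2\<close>: this triangular form drives both the moment recursion and the construction of eigenfunctions.\<close>

lemma laplacian_angular_monomial:
  assumes x: "x \<noteq> 0"
  shows "laplacian (angular_monomial a b) x = (inverse (norm x))\<^sup>2 * (real a * (real a - 1) * angular_monomial (a - 2) b x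
     + real b * (real b - 1) * angular_monomial a (b - 2) x - real (a + b) * real (a + b + 1) * angular_monomial a b x)"
proof -
  define m where "m = a + b"
  have n: "x $ 1 ^ 2 + x $ 2 ^ 2 + x $ 3 ^ 2 = (norm x)\<^sup>2"
    by (simp add: power2_norm_vec3)
  \<comment> \<open>The three terms in which both derivatives hit the power of the norm recombine because \<open>x\<^sub>1\<^sup>2 + x\<^sub>2\<^sup>2 + x\<^sub>3\<^sup>2 = \<bar>x\<bar>\<^sup>2\<close>.\<close>
  have s: "scaled_monomial (a + 2) b 0 (m + 4) x + scaled_monomial a (b + 2) 0 (m + 4) x + scaled_monomial a b 2 (m + 4) x = scaled_monomial a b 0 (m + 2) x"
  proof -
    have "scaled_monomial (a + 2) b 0 (m + 4) x + scaled_monomial a (b + 2) 0 (m + 4) x + scaled_monomial a b 2 (m + 4) x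
       = x $ 1 ^ a * x $ 2 ^ b * inverse (norm x) ^ (m + 4) * (x $ 1 ^ 2 + x $ 2 ^ 2 + x $ 3 ^ 2)"
      by (simp add: scaled_monomial_def power_add power2_eq_square algebra_simps)
    also have "\<dots> = x $ 1 ^ a * x $ 2 ^ b * inverse (norm x) ^ (m + 2) * (inverse (norm x) * norm x)\<^sup>2"
      unfolding n by (simp add: numeral_eq_Suc)
    also have "\<dots> = scaled_monomial a b 0 (m + 2) x" using x by (simp add: scaled_monomial_def)
    finally show ?thesis .
  qed
  \<comment> \<open>For \<open>a < 2\<close> the truncated index \<open>a - 2\<close> is meaningless, but the coefficient \<open>a (a - 1)\<close> then vanishes.\<close>
  have a: "real a * (real a - 1) * scaled_monomial (a - 2) b 0 m x = (inverse (norm x))\<^sup>2 * (real a * (real a - 1) * angular_monomial (a - 2) b x)"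
  proof (cases "a \<ge> 2")
    case True
    then have "m = (a - 2 + b) + 2" by (auto simp: m_def)
    then show ?thesis unfolding angular_monomial_eq_scaled_monomial scaled_monomial_def by (simp only: power_add) simp
  next
    case False
    then have "a = 0 \<or> a = 1" by auto
    then show ?thesis by auto
  qed
  have b: "real b * (real b - 1) * scaled_monomial a (b - 2) 0 m x = (inverse (norm x))\<^sup>2 * (real b * (real b - 1) * angular_monomial a (b - 2) x)"
  proof (cases "b \<ge> 2")
    case True
    then have "m = (a + (b - 2)) + 2" by (auto simp: m_def)
    then show ?thesis unfolding angular_monomial_eq_scaled_monomial scaled_monomial_def by (simp only: power_add) simp
  next
    case False
    then have "b = 0 \<or> b = 1" by auto
    then show ?thesis by auto
  qed
  have c: "scaled_monomial a b 0 (m + 2) x = (inverse (norm x))\<^sup>2 * angular_monomial a b x"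
    unfolding angular_monomial_eq_scaled_monomial scaled_monomial_def by (simp add: m_def power_add power2_eq_square)
  have "laplacian (angular_monomial a b) x = real a * (real a - 1) * scaled_monomial (a - 2) b 0 m x + real b * (real b - 1) * scaled_monomial a (b - 2) 0 m x
     - real m * (2 * real m + 3) * scaled_monomial a b 0 (m + 2) x
     + real m * (real m + 2) * (scaled_monomial (a + 2) b 0 (m + 4) x + scaled_monomial a (b + 2) 0 (m + 4) x + scaled_monomial a b 2 (m + 4) x)"
    unfolding laplacian_def angular_monomial_eq_scaled_monomial by (simp add: sum_3 partial_deriv2_scaled_monomial[OF x] m_def algebra_simps numeral_2_eq_2)
  then show ?thesis unfolding s a b c by (simp add: m_def algebra_simps)
qed

section \<open>Green's identity on a half-shell\<close>

text \<open>Integrals are taken over \<open>\<real> \<times> \<real> \<times> \<real>\<close>, where Fubini's theorem is available coordinate by coordinate, while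
the functions live on \<open>\<real>\<^sup>3\<close> as vectors.\<close>

definition of_triple :: "real \<times> real \<times> real \<Rightarrow> real^3" where
  "of_triple = (\<lambda>(x, y, z). vector [x, y, z])"

text \<open>The box contains the upper half of the ball of radius 2, outside of which the cutoff vanishes.\<close>

definition half_box :: "(real \<times> real \<times> real) set" where
  "half_box = cbox (- 2, - 2, 0) (2, 2, 2)"

lemma of_triple_nth [simp]: "of_triple (x, y, z) $ 1 = x" "of_triple (x, y, z) $ 2 = y" "of_triple (x, y, z) $ 3 = z"
  by (simp_all add: of_triple_def)

lemma of_triple_components: "of_triple (x $ 1, x $ 2, x $ 3) = x"
  by (simp add: vec_eq_iff forall_3)

lemma in_half_box: "(x, y, z) \<in> half_box \<longleftrightarrow> x \<in> {-2..2} \<and> y \<in> {-2..2} \<and> z \<in> {0..2}"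
  by (auto simp: half_box_def)

lemma continuous_on_of_triple: "continuous_on S of_triple"
proof -
  have e: "of_triple = (\<lambda>p. fst p *\<^sub>R axis 1 1 + fst (snd p) *\<^sub>R axis 2 1 + snd (snd p) *\<^sub>R axis 3 1)"
    by (auto simp: fun_eq_iff vec_eq_iff forall_3 axis_def of_triple_def)
  show ?thesis by (subst e) (intro continuous_intros)
qed

text \<open>Used along coordinate lines for the divergence theorem, along rays for homogeneity, and along meridians for
the Neumann condition. One-sided derivatives occur at the faces of the box and where a meridian leaves the equator.\<close>

lemma C1_on_along_curve:
  assumes "open W" "C1_on W f" "\<gamma> t \<in> W" "(\<gamma> has_vector_derivative v) (at t within S)"
  shows "((\<lambda>t. f (\<gamma> t)) has_real_derivative (\<Sum>i\<in>UNIV. partial_deriv i f (\<gamma> t) * v $ i)) (at t within S)"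
proof -
  have "((\<lambda>t. f (\<gamma> t)) has_derivative (\<lambda>h. \<Sum>i\<in>UNIV. partial_deriv i f (\<gamma> t) * (h *\<^sub>R v) $ i)) (at t within S)"
    using has_derivative_compose[OF assms(4)[unfolded has_vector_derivative_def] C1_on_has_derivative[OF assms(1-3)]] .
  then show ?thesis unfolding has_field_derivative_def
    by (rule has_derivative_eq_rhs) (simp add: fun_eq_iff sum_distrib_left algebra_simps)
qed

lemma of_triple_curves:
  "((\<lambda>t. of_triple (t, y, z)) has_vector_derivative axis 1 1) (at x within S)"
  "((\<lambda>t. of_triple (x, t, z)) has_vector_derivative axis 2 1) (at y within S)"
  "((\<lambda>t. of_triple (x, y, t)) has_vector_derivative axis 3 1) (at z within S)"
proof -
  have e: "(\<lambda>t. of_triple (t, y, z)) = (\<lambda>t. t *\<^sub>R axis 1 1 + of_triple (0, y, z))"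
    "(\<lambda>t. of_triple (x, t, z)) = (\<lambda>t. t *\<^sub>R axis 2 1 + of_triple (x, 0, z))"
    "(\<lambda>t. of_triple (x, y, t)) = (\<lambda>t. t *\<^sub>R axis 3 1 + of_triple (x, y, 0))"
    by (auto simp: fun_eq_iff vec_eq_iff forall_3 axis_def)
  show "((\<lambda>t. of_triple (t, y, z)) has_vector_derivative axis 1 1) (at x within S)"
  "((\<lambda>t. of_triple (x, t, z)) has_vector_derivative axis 2 1) (at y within S)"
  "((\<lambda>t. of_triple (x, y, t)) has_vector_derivative axis 3 1) (at z within S)"
    unfolding e by (auto intro!: derivative_eq_intros)
qed

lemma integral_half_box_swap_1:
  fixes f :: "real \<times> real \<times> real \<Rightarrow> real"
  assumes "continuous_on half_box f"
  shows "integral half_box f = integral (cbox (-2,0) (2,2)) (\<lambda>(y,z). integral {-2..2} (\<lambda>x. f (x,y,z)))"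
proof -
  have c: "continuous_on (cbox (-2, (-2, 0)) (2, (2, 2))) f" using assms unfolding half_box_def .
  then have c': "continuous_on (cbox (-2, (-2, 0)) (2, (2, 2))) (\<lambda>(x,w). f (x,w))" by simp
  show ?thesis unfolding half_box_def integral_prod_continuous[OF c]
    using integral_swap_continuous[OF c'] by (simp add: case_prod_unfold)
qed

lemma integral_half_box_slice:
  fixes f :: "real \<times> real \<times> real \<Rightarrow> real"
  assumes c: "continuous_on half_box f"
  shows "integral half_box f = integral {-2..2} (\<lambda>x. integral {-2..2} (\<lambda>y. integral {0..2} (\<lambda>z. f (x,y,z))))"
    and "integral half_box f = integral {-2..2} (\<lambda>x. integral {0..2} (\<lambda>z. integral {-2..2} (\<lambda>y. f (x,y,z))))"
proof -
  have c1: "continuous_on (cbox (-2, (-2, 0)) (2, (2, 2))) f" using assms unfolding half_box_def .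
  have c2: "continuous_on (cbox (-2, 0) (2, 2)) (\<lambda>(y, z). f (x,y,z))" if "x \<in> {-2..2}" for x
    using that by (simp add: case_prod_unfold)
      (intro continuous_on_compose2[OF c] continuous_intros, auto simp: half_box_def)
  have "integral half_box f = integral {-2..2} (\<lambda>x. integral (cbox (-2,0) (2,2)) (\<lambda>w. f (x, w)))"
    unfolding half_box_def integral_prod_continuous[OF c1] by simp
  also have "\<dots> = integral {-2..2} (\<lambda>x. integral {-2..2} (\<lambda>y. integral {0..2} (\<lambda>z. f (x,y,z))))"
    using integral_prod_continuous[OF c2] by (intro integral_cong) (simp add: case_prod_unfold)
  finally show "integral half_box f = integral {-2..2} (\<lambda>x. integral {-2..2} (\<lambda>y. integral {0..2} (\<lambda>z. f (x,y,z))))" .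
  also have "\<dots> = integral {-2..2} (\<lambda>x. integral {0..2} (\<lambda>z. integral {-2..2} (\<lambda>y. f (x,y,z))))"
    using integral_swap_continuous[OF c2] by (intro integral_cong) (simp add: case_prod_unfold)
  finally show "integral half_box f = integral {-2..2} (\<lambda>x. integral {0..2} (\<lambda>z. integral {-2..2} (\<lambda>y. f (x,y,z))))" .
qed

lemma integral_derivative_eq_0:
  fixes f :: "real \<Rightarrow> real"
  assumes "a \<le> b" "\<And>x. x \<in> {a..b} \<Longrightarrow> (f has_real_derivative f' x) (at x within {a..b})" "f a = 0" "f b = 0"
  shows "integral {a..b} f' = 0"
  using fundamental_theorem_of_calculus[of a b f f'] assms
  by (simp add: has_real_derivative_iff_has_vector_derivative integral_unique)

text \<open>Integrate each \<open>\<partial>\<^sub>i X\<^sub>i\<close> first in its own variable: the fundamental theorem of calculus leaves only boundary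
values, and these vanish.\<close>

lemma integral_divergence_half_box:
  assumes W: "open W" "of_triple ` half_box \<subseteq> W" and X: "\<And>i. C1_on W (X i)"
    and far: "\<And>i x. norm x \<ge> 2 \<Longrightarrow> X i x = 0"
    and flat: "\<And>x. x \<in> W \<Longrightarrow> x $ 3 = 0 \<Longrightarrow> X 3 x = 0"
  shows "integral half_box (\<lambda>p. \<Sum>i\<in>UNIV. partial_deriv i (X i) (of_triple p)) = 0"
proof -
  have c: "continuous_on half_box (\<lambda>p. partial_deriv i (X i) (of_triple p))" for i
    by (rule continuous_on_compose2[OF C1_on_continuous_partial[OF X] continuous_on_of_triple W(2)])
  \<comment> \<open>The five faces other than \<open>x\<^sub>3 = 0\<close> lie at distance at least 2 from the origin.\<close>
  have far': "X i x = 0" if "\<bar>x $ 1\<bar> = 2 \<or> \<bar>x $ 2\<bar> = 2 \<or> \<bar>x $ 3\<bar> = 2" for i x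
    using component_le_norm_cart[of x] that by (intro far) metis
  have inW: "of_triple (x, y, z) \<in> W" if "x \<in> {-2..2}" "y \<in> {-2..2}" "z \<in> {0..2}" for x y z
    using that W(2) by (auto simp: in_half_box)
  have 1: "integral {-2..2} (\<lambda>x. partial_deriv 1 (X 1) (of_triple (x, y, z))) = 0" if "y \<in> {-2..2}" "z \<in> {0..2}" for y z
  proof (rule integral_derivative_eq_0)
    show "((\<lambda>x. X 1 (of_triple (x, y, z))) has_real_derivative partial_deriv 1 (X 1) (of_triple (x, y, z))) (at x within {-2..2})"
      if "x \<in> {-2..2}" for x
      using C1_on_along_curve[OF W(1) X inW of_triple_curves(1)] that \<open>y \<in> _\<close> \<open>z \<in> _\<close> by (simp add: sum_3 axis_def)
  qed (simp_all add: far')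
  have 2: "integral {-2..2} (\<lambda>y. partial_deriv 2 (X 2) (of_triple (x, y, z))) = 0" if "x \<in> {-2..2}" "z \<in> {0..2}" for x z
  proof (rule integral_derivative_eq_0)
    show "((\<lambda>y. X 2 (of_triple (x, y, z))) has_real_derivative partial_deriv 2 (X 2) (of_triple (x, y, z))) (at y within {-2..2})"
      if "y \<in> {-2..2}" for y
      using C1_on_along_curve[OF W(1) X inW of_triple_curves(2)] that \<open>x \<in> _\<close> \<open>z \<in> _\<close> by (simp add: sum_3 axis_def)
  qed (simp_all add: far')
  have 3: "integral {0..2} (\<lambda>z. partial_deriv 3 (X 3) (of_triple (x, y, z))) = 0" if "x \<in> {-2..2}" "y \<in> {-2..2}" for x y
  proof (rule integral_derivative_eq_0)
    show "((\<lambda>z. X 3 (of_triple (x, y, z))) has_real_derivative partial_deriv 3 (X 3) (of_triple (x, y, z))) (at z within {0..2})"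
      if "z \<in> {0..2}" for z
      using C1_on_along_curve[OF W(1) X inW of_triple_curves(3)] that \<open>x \<in> _\<close> \<open>y \<in> _\<close> by (simp add: sum_3 axis_def)
  qed (use that in \<open>simp_all add: far' flat inW\<close>)
  have "integral half_box (\<lambda>p. partial_deriv 1 (X 1) (of_triple p)) = 0"
    unfolding integral_half_box_swap_1[OF c] by (rule integral_unique[OF has_integral_is_0]) (auto simp: 1)
  moreover have "integral half_box (\<lambda>p. partial_deriv 2 (X 2) (of_triple p)) = 0"
    unfolding integral_half_box_slice(2)[OF c] by (rule integral_unique[OF has_integral_is_0], rule integral_unique[OF has_integral_is_0]) (simp add: 2)
  moreover have "integral half_box (\<lambda>p. partial_deriv 3 (X 3) (of_triple p)) = 0"
    unfolding integral_half_box_slice(1)[OF c] by (rule integral_unique[OF has_integral_is_0], rule integral_unique[OF has_integral_is_0]) (simp add: 3)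
  moreover have "(\<lambda>p. partial_deriv i (X i) (of_triple p)) integrable_on half_box" for i
    using c unfolding half_box_def by (rule integrable_continuous)
  ultimately have "((\<lambda>p. partial_deriv 1 (X 1) (of_triple p) + partial_deriv 2 (X 2) (of_triple p) + partial_deriv 3 (X 3) (of_triple p))
      has_integral 0 + 0 + 0) half_box"
    by (intro has_integral_add) (simp_all add: has_integral_iff)
  then show ?thesis unfolding sum_3 by (simp add: integral_unique)
qed

text \<open>A radial function supported in the shell \<open>1 \<le> \<bar>x\<bar> \<le> 2\<close>. The square makes it continuously differentiable.\<close>

definition cutoff :: "real^3 \<Rightarrow> real" where
  "cutoff x = (max 0 (((norm x)\<^sup>2 - 1) * (4 - (norm x)\<^sup>2)))\<^sup>2"

lemma has_derivative_max_0_square: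
  "((\<lambda>t. (max 0 t)\<^sup>2) has_real_derivative 2 * max 0 t) (at (t::real))"
proof -
  consider "t < 0" | "t > 0" | "t = 0" by linarith
  then show ?thesis
  proof cases
    case 1
    show ?thesis
      by (rule has_field_derivative_transform_within_open[of "\<lambda>_. 0" _ _ "{..<0}"]) (use 1 in \<open>auto simp: max_def\<close>)
  next
    case 2
    show ?thesis
      by (rule has_field_derivative_transform_within_open[of "\<lambda>t. t\<^sup>2" _ _ "{0<..}"])
        (use 2 in \<open>auto simp: max_def intro!: derivative_eq_intros\<close>)
  next
    case 3
    have "((\<lambda>h::real. max 0 h) \<longlongrightarrow> max 0 0) (at 0)" by (intro tendsto_intros)
    moreover have "(\<lambda>h::real. (max 0 h)\<^sup>2 / h) = max 0" by (auto simp: fun_eq_iff max_def power2_eq_square)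
    ultimately show ?thesis using 3 by (simp add: has_field_derivative_iff)
  qed
qed

lemma
  shows C1_on_cutoff: "C1_on UNIV cutoff"
    and partial_deriv_cutoff: "\<exists>c. \<forall>i. partial_deriv i cutoff x = c * x $ i"
proof -
  define c where "c x = 2 * max 0 ((x \<bullet> x - 1) * (4 - x \<bullet> x)) * (5 - 2 * (x \<bullet> x)) * 2" for x :: "real^3"
  have d: "(cutoff has_derivative (\<lambda>h. \<Sum>i\<in>UNIV. (c x * x $ i) * h $ i)) (at x)" for x
  proof -
    have 1: "((\<lambda>x. (x \<bullet> x - 1) * (4 - x \<bullet> x)) has_derivative (\<lambda>h. (5 - 2 * (x \<bullet> x)) * (2 * (x \<bullet> h)))) (at x)"
      by (auto intro!: derivative_eq_intros simp: fun_eq_iff inner_commute algebra_simps)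
    have "((\<lambda>x. (max 0 ((x \<bullet> x - 1) * (4 - x \<bullet> x)))\<^sup>2) has_derivative
       (\<lambda>h. 2 * max 0 ((x \<bullet> x - 1) * (4 - x \<bullet> x)) * ((5 - 2 * (x \<bullet> x)) * (2 * (x \<bullet> h))))) (at x)"
      using has_derivative_compose[OF 1 has_derivative_max_0_square[unfolded has_field_derivative_def]] .
    then show ?thesis unfolding cutoff_def[abs_def] power2_norm_eq_inner
      by (rule has_derivative_eq_rhs) (simp add: fun_eq_iff c_def inner_vec_def sum_3 algebra_simps)
  qed
  have "continuous_on UNIV (\<lambda>x. c x * x $ i)" for i unfolding c_def by (intro continuous_intros)
  note * = C1_onI[OF open_UNIV d this, simplified]
  show "C1_on UNIV cutoff" by (rule *)
  show "\<exists>c. \<forall>i. partial_deriv i cutoff x = c * x $ i" using *(2) by blast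
qed

lemma cutoff_eq_0: "norm x \<le> 1 \<or> norm x \<ge> 2 \<Longrightarrow> cutoff x = 0"
proof -
  assume "norm x \<le> 1 \<or> norm x \<ge> 2"
  then have "(norm x)\<^sup>2 \<le> 1 \<or> (norm x)\<^sup>2 \<ge> 4" using power_mono[of 2 "norm x" 2] by (auto simp: power_le_one)
  then have "((norm x)\<^sup>2 - 1) * (4 - (norm x)\<^sup>2) \<le> 0"
    by (auto simp: mult_le_0_iff)
  then show ?thesis by (simp add: cutoff_def max_def)
qed

lemma cutoff_nonneg: "cutoff x \<ge> 0"
  by (simp add: cutoff_def)

lemma C1_on_Un:
  assumes "open V" "open W" "C1_on V f" "C1_on W f"
  shows "C1_on (V \<union> W) f"
  using assms unfolding C1_on_def
  by (auto intro!: continuous_on_open_Un simp: differentiable_on_eq_differentiable_at open_Un)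

definition punctured_halfspace :: "(real^3) set" where
  "punctured_halfspace = {x. x \<noteq> 0 \<and> x $ 3 \<ge> 0}"

text \<open>The common properties of extended eigenfunctions and of angular monomials that enter Green's identity: the
gradient is tangential to the spheres around the origin, and its normal component vanishes on the plane
\<open>x\<^sub>3 = 0\<close>. The domain reaches beyond this plane, which makes all derivatives continuous up to it.\<close>

definition neumann_field :: "(real^3) set \<Rightarrow> (real^3 \<Rightarrow> real) \<Rightarrow> bool" where
  "neumann_field W G \<longleftrightarrow> open W \<and> 0 \<notin> W \<and> punctured_halfspace \<subseteq> W \<and> C2_on W G \<and>
     (\<forall>x\<in>W. (\<Sum>i\<in>UNIV. x $ i * partial_deriv i G x) = 0) \<and>
     (\<forall>x\<in>W. x $ 3 = 0 \<longrightarrow> partial_deriv 3 G x = 0)"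

lemma C1_on_cutoff_mult:
  assumes "open W" "C1_on W f"
  shows "C1_on (W \<union> ball 0 1) (\<lambda>x. cutoff x * f x)"
proof (rule C1_on_Un)
  show "C1_on W (\<lambda>x. cutoff x * f x)"
    using assms C1_on_cutoff by (auto intro: C1_on_mult C1_on_subset)
  have "C1_on (ball 0 1) (\<lambda>x. cutoff x * f x) \<longleftrightarrow> C1_on (ball 0 1) (\<lambda>x. 0)"
    by (rule C1_on_cong) (auto simp: cutoff_eq_0)
  then show "C1_on (ball 0 1) (\<lambda>x. cutoff x * f x)" by (simp add: C1_on_const)
qed (use assms in auto)

lemma of_triple_half_box_subset:
  assumes "punctured_halfspace \<subseteq> W" shows "of_triple ` half_box \<subseteq> W \<union> ball 0 1"
  using assms by (auto simp: punctured_halfspace_def in_half_box)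

text \<open>This is the divergence theorem for the field \<open>cutoff (G \<nabla>H - H \<nabla>G)\<close>. Its divergence has no term with the derivative of
the cutoff because that derivative is radial and the gradients of \<open>G\<close> and \<open>H\<close> are tangential.\<close>

lemma green_half_box:
  assumes "neumann_field W G" "neumann_field W H"
  shows "integral half_box (\<lambda>p. cutoff (of_triple p) * (G (of_triple p) * laplacian H (of_triple p) - H (of_triple p) * laplacian G (of_triple p))) = 0"
proof -
  have W: "open W" "0 \<notin> W" "punctured_halfspace \<subseteq> W" and G: "C2_on W G" and H: "C2_on W H"
    using assms by (auto simp: neumann_field_def)
  note C1 = G[THEN C2_on_imp_C1_on] H[THEN C2_on_imp_C1_on] G[THEN C2_on_C1_on_partial] H[THEN C2_on_C1_on_partial]
  define Y where "Y i x = 1 * (G x * partial_deriv i H x) + (-1) * (H x * partial_deriv i G x)" for i x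
  have Y: "C1_on W (Y i)" for i unfolding Y_def
    by (intro C1_on_add C1_on_mult C1_on_const C1 W)
  define X where "X i x = cutoff x * Y i x" for i x
  have X: "C1_on (W \<union> ball 0 1) (X i)" for i unfolding X_def
    by (rule C1_on_cutoff_mult[OF W(1) Y])
  have flat: "X 3 x = 0" if "x \<in> W \<union> ball 0 1" "x $ 3 = 0" for x
    using that assms by (auto simp: X_def cutoff_eq_0 Y_def neumann_field_def)
  have "integral half_box (\<lambda>p. \<Sum>i\<in>UNIV. partial_deriv i (X i) (of_triple p)) = 0"
    by (rule integral_divergence_half_box[OF _ of_triple_half_box_subset[OF W(3)] X])
       (use flat W in \<open>auto simp: X_def cutoff_eq_0\<close>)
  moreover have div: "(\<Sum>i\<in>UNIV. partial_deriv i (X i) x) = cutoff x * (G x * laplacian H x - H x * laplacian G x)" if x: "x \<in> W \<union> ball 0 1" for x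
  proof (cases "x \<in> ball 0 1")
    case True
    \<comment> \<open>Near the origin the cutoff vanishes, so the possibly singular factor is invisible.\<close>
    have "partial_deriv i (X i) x = partial_deriv i (\<lambda>_. 0) x" for i
      by (rule partial_deriv_cong_open[OF _ True]) (auto simp: X_def cutoff_eq_0)
    then show ?thesis using True by (simp add: partial_deriv_const[of UNIV] cutoff_eq_0)
  next
    case False
    then have x: "x \<in> W" using x by auto
    have Y': "partial_deriv i (Y i) x = G x * partial_deriv i (partial_deriv i H) x - H x * partial_deriv i (partial_deriv i G) x" for i
    proof -
      have "partial_deriv i (Y i) x = 1 * partial_deriv i (\<lambda>x. G x * partial_deriv i H x) x + (-1) * partial_deriv i (\<lambda>x. H x * partial_deriv i G x) x"
        unfolding Y_def[abs_def] by (rule partial_deriv_lincomb[OF W(1) _ _ x]) (intro C1_on_mult C1 W)+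
      then show ?thesis by (simp add: partial_deriv_mult[OF W(1) C1(1) C1(4) x] partial_deriv_mult[OF W(1) C1(2) C1(3) x])
    qed
    \<comment> \<open>The gradient of the cutoff is radial, and the gradients of \<open>G\<close> and \<open>H\<close> are orthogonal to it.\<close>
    obtain c where c: "\<And>i. partial_deriv i cutoff x = c * x $ i" using partial_deriv_cutoff by blast
    have "partial_deriv i (X i) x = c * x $ i * Y i x + cutoff x * partial_deriv i (Y i) x" for i
      unfolding X_def[abs_def] using partial_deriv_mult[OF W(1) C1_on_subset[OF C1_on_cutoff subset_UNIV] Y x] by (simp add: c)
    note Xi = this
    have "(\<Sum>i\<in>UNIV. partial_deriv i (X i) x) =
        c * (G x * (\<Sum>i\<in>UNIV. x $ i * partial_deriv i H x) - H x * (\<Sum>i\<in>UNIV. x $ i * partial_deriv i G x))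
        + cutoff x * (G x * laplacian H x - H x * laplacian G x)"
      unfolding Xi Y' Y_def laplacian_def by (simp add: sum_3 algebra_simps)
    then show ?thesis using assms x by (simp add: neumann_field_def)
  qed
  moreover have "integral half_box (\<lambda>p. \<Sum>i\<in>UNIV. partial_deriv i (X i) (of_triple p))
     = integral half_box (\<lambda>p. cutoff (of_triple p) * (G (of_triple p) * laplacian H (of_triple p) - H (of_triple p) * laplacian G (of_triple p)))"
    by (rule integral_cong) (use of_triple_half_box_subset[OF W(3)] div in blast)
  ultimately show ?thesis by simp
qed

section \<open>Homogeneous extension of eigenfunctions\<close>

lemma closed_hemisphere_iff: "x \<in> closed_hemisphere \<longleftrightarrow> norm x = 1 \<and> x $ 3 \<ge> 0"
  by (auto simp: closed_hemisphere_def hemisphere_def equator_def)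

lemma normalize_in_closed_hemisphere: "x \<in> punctured_halfspace \<Longrightarrow> x /\<^sub>R norm x \<in> closed_hemisphere"
  by (auto simp: punctured_halfspace_def closed_hemisphere_iff)

lemma radial_derivative_eq_0:
  assumes "open W" "C1_on W G" "x \<in> W" "\<And>c. c > 0 \<Longrightarrow> G (c *\<^sub>R x) = G x"
  shows "(\<Sum>i\<in>UNIV. x $ i * partial_deriv i G x) = 0"
proof -
  have "((\<lambda>t. t *\<^sub>R x) has_vector_derivative x) (at 1)" by (auto intro!: derivative_eq_intros)
  from C1_on_along_curve[OF assms(1,2) _ this] assms(3)
  have 1: "((\<lambda>t. G (t *\<^sub>R x)) has_real_derivative (\<Sum>i\<in>UNIV. partial_deriv i G x * x $ i)) (at 1)" by simp
  have 2: "((\<lambda>t. G (t *\<^sub>R x)) has_real_derivative 0) (at 1)"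
    by (rule has_field_derivative_transform_within_open[of "\<lambda>_. G x" _ _ "{0<..}"]) (use assms(4) in auto)
  show ?thesis using DERIV_unique[OF 1 2] by (simp add: mult.commute)
qed

lemma partial_deriv_scaleR:
  assumes "f differentiable (at (c *\<^sub>R x))"
  shows "partial_deriv i (\<lambda>y. f (c *\<^sub>R y)) x = c * partial_deriv i f (c *\<^sub>R x)"
proof -
  have "((\<lambda>y. c *\<^sub>R y) has_derivative (\<lambda>h. c *\<^sub>R h)) (at x)" by (auto intro!: derivative_eq_intros)
  from partial_deriv_eq[OF has_derivative_compose[OF this has_derivative_partial_derivs[OF assms]], of i]
  show ?thesis by (simp add: axis_def if_distrib cong: if_cong)
qed

lemma
  assumes W: "open W" "\<And>c x. c > 0 \<Longrightarrow> x \<in> W \<Longrightarrow> c *\<^sub>R x \<in> W" and G: "C2_on W G"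
    and hom: "\<And>c x. c > 0 \<Longrightarrow> G (c *\<^sub>R x) = G x" and c: "c > 0"
  shows partial_deriv_homogeneous: "x \<in> W \<Longrightarrow> partial_deriv i G (c *\<^sub>R x) = inverse c * partial_deriv i G x"
    and laplacian_homogeneous: "x \<in> W \<Longrightarrow> laplacian G (c *\<^sub>R x) = (inverse c)\<^sup>2 * laplacian G x"
proof -
  have d: "G differentiable (at (c *\<^sub>R x))" "partial_deriv i G differentiable (at (c *\<^sub>R x))" if "x \<in> W" for x i
    using differentiable_on_open_at[OF _ W(1) W(2)[OF c that]] G by (auto simp: C2_on_def)
  show 1: "partial_deriv i G (c *\<^sub>R x) = inverse c * partial_deriv i G x" if "x \<in> W" for x i
    using partial_deriv_scaleR[OF d(1)[OF that], of i] c by (simp add: hom field_simps)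
  have 2: "partial_deriv i (partial_deriv i G) (c *\<^sub>R x) = (inverse c)\<^sup>2 * partial_deriv i (partial_deriv i G) x" if "x \<in> W" for x i
  proof -
    have "c * partial_deriv i (partial_deriv i G) (c *\<^sub>R x) = partial_deriv i (\<lambda>y. partial_deriv i G (c *\<^sub>R y)) x"
      by (rule partial_deriv_scaleR[OF d(2)[OF that], symmetric])
    also have "\<dots> = partial_deriv i (\<lambda>y. inverse c * partial_deriv i G y + 0 * partial_deriv i G y) x"
      by (rule partial_deriv_cong_open[OF W(1) that]) (simp add: 1)
    also have "\<dots> = inverse c * partial_deriv i (partial_deriv i G) x"
      using C2_on_C1_on_partial[OF G] W that by (subst partial_deriv_lincomb[of W]) auto
    finally show ?thesis using c by (simp add: field_simps power2_eq_square)
  qed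
  show "laplacian G (c *\<^sub>R x) = (inverse c)\<^sup>2 * laplacian G x" if "x \<in> W" for x
    unfolding laplacian_def by (simp add: 2[OF that] sum_distrib_left)
qed

lemma meridian:
  assumes "p \<in> equator" "t \<in> {0..pi}"
  shows "cos t *\<^sub>R p + sin t *\<^sub>R axis 3 1 \<in> closed_hemisphere"
proof -
  have p: "p $ 3 = 0" "norm p = 1" using assms by (auto simp: equator_def)
  then have "(p $ 1)\<^sup>2 + (p $ 2)\<^sup>2 = 1" using power2_norm_vec3[of p] by simp
  moreover have "(norm (cos t *\<^sub>R p + sin t *\<^sub>R axis 3 1))\<^sup>2 = (cos t)\<^sup>2 * ((p $ 1)\<^sup>2 + (p $ 2)\<^sup>2) + (sin t)\<^sup>2"
    unfolding power2_norm_vec3 using p by (simp add: axis_def power2_eq_square algebra_simps)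
  ultimately have "(norm (cos t *\<^sub>R p + sin t *\<^sub>R axis 3 1))\<^sup>2 = 1" by simp
  then have "norm (cos t *\<^sub>R p + sin t *\<^sub>R axis 3 1) = 1" by (simp add: abs_square_eq_1 power2_eq_1_iff)
  then show ?thesis using p assms by (simp add: closed_hemisphere_iff sin_ge_zero)
qed

lemma meridian_derivative:
  assumes W: "open W" "C1_on W G" "p \<in> equator" "p \<in> W" and eq: "\<And>x. x \<in> closed_hemisphere \<Longrightarrow> G x = u x"
  shows "((\<lambda>t. u (cos t *\<^sub>R p + sin t *\<^sub>R axis 3 1)) has_real_derivative partial_deriv 3 G p) (at 0 within {0..})"
proof (rule has_field_derivative_transform_within[where d=pi])
  have "((\<lambda>t. cos t *\<^sub>R p + sin t *\<^sub>R axis 3 1) has_vector_derivative axis 3 1) (at 0 within {0..})"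
    by (auto intro!: derivative_eq_intros)
  from C1_on_along_curve[OF W(1,2) _ this] W(4)
  show "((\<lambda>t. G (cos t *\<^sub>R p + sin t *\<^sub>R axis 3 1)) has_real_derivative partial_deriv 3 G p) (at 0 within {0..})"
    by (simp add: sum_3 axis_def)
qed (use W meridian in \<open>auto intro!: eq simp: dist_norm\<close>)

text \<open>The meridian leaves the equator with velocity \<open>e\<^sub>3\<close>, so the one-sided derivative along it is \<open>\<partial>\<^sub>3 G\<close> for every
\<open>C1_on\<close> extension \<open>G\<close>.\<close>

lemma neumann_condition_iff:
  assumes W: "open W" "C1_on W G" "equator \<subseteq> W" and eq: "\<And>x. x \<in> closed_hemisphere \<Longrightarrow> G x = u x"
  shows "neumann_condition u \<longleftrightarrow> (\<forall>p\<in>equator. partial_deriv 3 G p = 0)"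
proof -
  have "((\<lambda>t. u (cos t *\<^sub>R p + sin t *\<^sub>R axis 3 1)) has_real_derivative 0) (at 0 within {0..})
     \<longleftrightarrow> partial_deriv 3 G p = 0" if "p \<in> equator" for p
  proof -
    have d: "((\<lambda>t. u (cos t *\<^sub>R p + sin t *\<^sub>R axis 3 1)) has_real_derivative partial_deriv 3 G p) (at 0 within {0..})"
      using meridian_derivative[OF W(1,2) that _ eq] W(3) that by auto
    have nb: "at (0::real) within {0..} \<noteq> bot"
      unfolding at_within_Ici_at_right by (rule trivial_limit_at_right_real)
    show ?thesis
    proof
      assume a: "((\<lambda>t. u (cos t *\<^sub>R p + sin t *\<^sub>R axis 3 1)) has_real_derivative 0) (at 0 within {0..})"
      show "partial_deriv 3 G p = 0"
        by (rule vector_derivative_unique_within[OF nb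
            d[unfolded has_real_derivative_iff_has_vector_derivative] a[unfolded has_real_derivative_iff_has_vector_derivative]])
    next
      assume "partial_deriv 3 G p = 0"
      from d[unfolded this] show "((\<lambda>t. u (cos t *\<^sub>R p + sin t *\<^sub>R axis 3 1)) has_real_derivative 0) (at 0 within {0..})" .
    qed
  qed
  then show ?thesis unfolding neumann_condition_def by auto
qed

text \<open>Compose a \<open>C\<^sup>2\<close> extension \<open>F\<close> of \<open>u\<close> with the projection \<open>x \<mapsto> x/\<bar>x\<bar>\<close>. The result is homogeneous of degree zero,
so its gradient is tangential, and the equations that hold on the unit sphere scale to the whole
half-space.\<close>

lemma eigenfunction_extension:
  assumes u: "u \<in> neumann_eigenspace \<mu>"
  obtains W G where "neumann_field W G" "\<And>x. x \<in> punctured_halfspace \<Longrightarrow> G x = u (x /\<^sub>R norm x)"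
    "\<And>x. x $ 3 > 0 \<Longrightarrow> laplacian G x = - \<mu> * (inverse (norm x))\<^sup>2 * G x"
    "continuous_on closed_hemisphere u"
proof -
  obtain V F where V: "open V" "closed_hemisphere \<subseteq> V" and F: "C2_on V F"
      and Fu: "\<And>x. x \<in> closed_hemisphere \<Longrightarrow> F x = u x"
    using u by (auto simp: neumann_eigenspace_def C2_closed_hemisphere_def)
  define W where "W = {x. x \<noteq> 0 \<and> x /\<^sub>R norm x \<in> V}"
  define G where "G x = F (x /\<^sub>R norm x)" for x
  have "continuous_on (- {0}) (\<lambda>x::real^3. x /\<^sub>R norm x)" by (intro continuous_intros) auto
  from continuous_open_preimage[OF this _ V(1)]
  have "open (- {0} \<inter> (\<lambda>x::real^3. x /\<^sub>R norm x) -` V)" by auto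
  also have "- {0} \<inter> (\<lambda>x::real^3. x /\<^sub>R norm x) -` V = W" by (auto simp: W_def)
  finally have oW: "open W" .
  have upW: "punctured_halfspace \<subseteq> W" using normalize_in_closed_hemisphere V by (auto simp: W_def punctured_halfspace_def)
  have cone: "c *\<^sub>R x \<in> W" if "c > 0" "x \<in> W" for c x using that by (auto simp: W_def field_simps)
  have hom: "G (c *\<^sub>R x) = G x" if "c > 0" for c x using that by (cases "x = 0") (auto simp: G_def field_simps)
  have "C2_on W (\<lambda>x. inverse (norm x) * x $ j)" for j
    by (intro C2_on_mult C2_on_component C2_on_inverse_norm oW) (auto simp: W_def)
  then have CG: "C2_on W G" unfolding G_def
    by (intro C2_on_compose[OF oW V(1) F]) (auto simp: W_def)
  have Gu: "G x = u (x /\<^sub>R norm x)" if "x \<in> punctured_halfspace" for x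
    unfolding G_def by (intro Fu normalize_in_closed_hemisphere that)
  have eqW: "equator \<subseteq> W" using upW by (auto simp: equator_def punctured_halfspace_def)
  have Gu': "G x = u x" if "x \<in> closed_hemisphere" for x
    using that Gu[of x] by (cases "x = 0") (auto simp: closed_hemisphere_iff punctured_halfspace_def)
  have N: "partial_deriv 3 G p = 0" if "p \<in> equator" for p
    using u neumann_condition_iff[OF oW C2_on_imp_C1_on[OF CG] eqW Gu'] that by (auto simp: neumann_eigenspace_def)
  have N': "partial_deriv 3 G x = 0" if "x \<in> W" "x $ 3 = 0" for x
  proof -
    have "x \<noteq> 0" using that by (auto simp: W_def)
    then have p: "x /\<^sub>R norm x \<in> equator" using that by (auto simp: equator_def)
    then show ?thesis
      using partial_deriv_homogeneous[OF oW cone CG hom, of "norm x" "x /\<^sub>R norm x" 3] eqW \<open>x \<noteq> 0\<close> N by auto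
  qed
  have "neumann_field W G" unfolding neumann_field_def
    using oW upW CG N' radial_derivative_eq_0[OF oW C2_on_imp_C1_on[OF CG] _ hom] by (auto simp: W_def)
  moreover have "laplacian G x = - \<mu> * (inverse (norm x))\<^sup>2 * G x" if "x $ 3 > 0" for x
  proof -
    have x: "x \<noteq> 0" "x \<in> punctured_halfspace" using that by (auto simp: punctured_halfspace_def)
    define y where "y = x /\<^sub>R norm x"
    have y: "y \<in> hemisphere" using that x by (auto simp: y_def hemisphere_def)
    have yW: "y \<in> W" using y upW by (auto simp: hemisphere_def punctured_halfspace_def)
    have "laplacian G y = laplacian (\<lambda>y. u (y /\<^sub>R norm y)) y"
    proof (rule laplacian_cong_open)
      show "open {x :: real^3. x $ 3 > 0}" by (rule open_halfspace_component_gt_cart)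
      show "y \<in> {x. x $ 3 > 0}" using y by (auto simp: hemisphere_def)
      show "G z = u (z /\<^sub>R norm z)" if "z \<in> {x. x $ 3 > 0}" for z using that by (intro Gu) (auto simp: punctured_halfspace_def)
    qed
    also have "\<dots> = sphere_laplacian u y" by (simp add: laplacian_def sphere_laplacian_def)
    also have "\<dots> = - \<mu> * u y" using u y by (auto simp: neumann_eigenspace_def)
    also have "\<dots> = - \<mu> * G x" using x by (simp add: Gu y_def)
    finally have "laplacian G y = - \<mu> * G x" .
    \<comment> \<open>The eigenvalue equation is known on the unit sphere; homogeneity carries it along the ray of \<open>x\<close>.\<close>
    moreover have "x = norm x *\<^sub>R y" using x by (simp add: y_def)
    ultimately show ?thesis
      using laplacian_homogeneous[OF oW cone CG hom _ yW, of "norm x"] x by simp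
  qed
  moreover have "continuous_on closed_hemisphere u"
    using continuous_on_subset[OF C1_on_continuous[OF C2_on_imp_C1_on[OF F]] V(2)] Fu by (simp cong: continuous_on_cong)
  ultimately show ?thesis using Gu by (intro that)
qed

lemma angular_monomial_scaleR: "c > 0 \<Longrightarrow> angular_monomial a b (c *\<^sub>R x) = angular_monomial a b x"
  by (simp add: angular_monomial_def)

lemma partial_deriv_3_angular_monomial: "x \<noteq> 0 \<Longrightarrow> x $ 3 = 0 \<Longrightarrow> partial_deriv 3 (angular_monomial a b) x = 0"
  unfolding angular_monomial_eq_scaled_monomial by (simp add: partial_deriv_scaled_monomial) (simp add: scaled_monomial_def)

lemma neumann_field_angular_monomial:
  assumes "open W" "0 \<notin> W" "punctured_halfspace \<subseteq> W" shows "neumann_field W (angular_monomial a b)"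
proof -
  have "C2_on W (angular_monomial a b)" by (rule C2_on_subset[OF C2_on_angular_monomial]) (use assms in auto)
  then show ?thesis using assms unfolding neumann_field_def
    by (auto intro!: radial_derivative_eq_0[of W] C2_on_imp_C1_on partial_deriv_3_angular_monomial angular_monomial_scaleR)
qed

section \<open>Angular polynomials and their density\<close>

text \<open>The span of the angular monomials of degree less than \<open>n\<close>. The strict bound lets \<open>n = 0\<close> stand for the
zero space, and a correction to a monomial of degree \<open>l\<close> has bound \<open>l\<close>.\<close>

inductive angular_polynomial :: "nat \<Rightarrow> (real^3 \<Rightarrow> real) \<Rightarrow> bool" for n where
  zero: "angular_polynomial n (\<lambda>x. 0)"
| step: "angular_polynomial n p \<Longrightarrow> a + b < n \<Longrightarrow> angular_polynomial n (\<lambda>x. c * angular_monomial a b x + p x)"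

lemma angular_polynomial_mono: "angular_polynomial n p \<Longrightarrow> n \<le> m \<Longrightarrow> angular_polynomial m p"
  by (induction rule: angular_polynomial.induct) (auto intro: angular_polynomial.intros)

lemma angular_polynomial_angular_monomial: "a + b < n \<Longrightarrow> angular_polynomial n (angular_monomial a b)"
  using angular_polynomial.step[OF angular_polynomial.zero, of a b n 1] by simp

lemma angular_polynomial_add: "angular_polynomial n p \<Longrightarrow> angular_polynomial n q \<Longrightarrow> angular_polynomial n (\<lambda>x. p x + q x)"
  by (induction rule: angular_polynomial.induct) (auto simp: add.assoc intro: angular_polynomial.intros)

lemma angular_polynomial_scale: "angular_polynomial n p \<Longrightarrow> angular_polynomial n (\<lambda>x. c * p x)"
  by (induction rule: angular_polynomial.induct) (auto simp: ring_distribs mult.assoc[symmetric] intro: angular_polynomial.intros)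

lemma angular_monomial_mult: "angular_monomial a b x * angular_monomial c d x = angular_monomial (a + c) (b + d) x"
  by (simp add: angular_monomial_def power_add)

lemma angular_polynomial_angular_monomial_mult:
  "angular_polynomial n p \<Longrightarrow> angular_polynomial (n + a + b) (\<lambda>x. c * angular_monomial a b x * p x)"
proof (induction rule: angular_polynomial.induct)
  case (step p a' b' c')
  have "angular_polynomial (n + a + b) (\<lambda>x. (c * c') * angular_monomial (a + a') (b + b') x + c * angular_monomial a b x * p x)"
    by (rule angular_polynomial.step) (use step in auto)
  then show ?case by (simp add: angular_monomial_mult[symmetric] algebra_simps)
qed (simp add: angular_polynomial.zero)

lemma angular_polynomial_mult: "angular_polynomial n p \<Longrightarrow> angular_polynomial m q \<Longrightarrow> angular_polynomial (n + m) (\<lambda>x. p x * q x)"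
proof (induction rule: angular_polynomial.induct)
  case (step p a b c)
  have "angular_polynomial (n + m) (\<lambda>x. c * angular_monomial a b x * q x)"
    by (rule angular_polynomial_mono[OF angular_polynomial_angular_monomial_mult[OF step(4)]]) (use step in auto)
  from angular_polynomial_add[OF this step(3)[OF step(4)]] show ?case by (simp add: algebra_simps)
qed (simp add: angular_polynomial.zero)

lemma angular_polynomial_C2_on: "angular_polynomial n p \<Longrightarrow> C2_on (- {0}) p"
  by (induction rule: angular_polynomial.induct) (auto intro!: C2_on_add C2_on_mult C2_on_const C2_on_angular_monomial)

lemma angular_polynomial_scaleR: "angular_polynomial n p \<Longrightarrow> c > 0 \<Longrightarrow> p (c *\<^sub>R x) = p x"
  by (induction rule: angular_polynomial.induct) (auto simp: angular_monomial_scaleR)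

lemma closed_hemisphere_eqI:
  assumes "x \<in> closed_hemisphere" "y \<in> closed_hemisphere" "x $ 1 = y $ 1" "x $ 2 = y $ 2"
  shows "x = y"
proof -
  have "(z $ 3)\<^sup>2 = 1 - (z $ 1)\<^sup>2 - (z $ 2)\<^sup>2" if "z \<in> closed_hemisphere" for z
    using power2_norm_vec3[of z] that by (simp add: closed_hemisphere_iff)
  then have "(x $ 3)\<^sup>2 = (y $ 3)\<^sup>2" using assms by metis
  then have "x $ 3 = y $ 3" using assms by (simp add: closed_hemisphere_iff power2_eq_iff_nonneg)
  then show ?thesis using assms by (simp add: vec_eq_iff forall_3)
qed

text \<open>The angular polynomials form an algebra with constants, and they separate points of the closed hemisphere since a
point is determined by its first two coordinates, so the Stone--Weierstrass theorem applies.\<close>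

lemma angular_polynomial_dense:
  assumes "continuous_on closed_hemisphere u" "e > 0"
  obtains n p where "angular_polynomial n p" "\<And>x. x \<in> closed_hemisphere \<Longrightarrow> \<bar>u x - p x\<bar> < e"
proof -
  interpret function_ring_on "{p. \<exists>n. angular_polynomial n p}" closed_hemisphere
  proof
    have "closed_hemisphere = sphere 0 1 \<inter> {x. x $ 3 \<ge> 0}" by (auto simp: closed_hemisphere_iff)
    moreover have "compact (sphere 0 1 \<inter> {x::real^3. x $ 3 \<ge> 0})"
      using closed_halfspace_component_ge_cart[of 0 3] by (intro compact_Int_closed) auto
    ultimately show "compact closed_hemisphere" by simp
    show "continuous_on closed_hemisphere f" if "f \<in> {p. \<exists>n. angular_polynomial n p}" for f
      using that continuous_on_subset[OF C1_on_continuous[OF C2_on_imp_C1_on[OF angular_polynomial_C2_on]], of _ f closed_hemisphere]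
      by (auto simp: closed_hemisphere_iff)
    show "(\<lambda>_. c) \<in> {p. \<exists>n. angular_polynomial n p}" for c
    proof -
      have "angular_polynomial 1 (\<lambda>x. c * angular_monomial 0 0 x + 0)" by (rule angular_polynomial.step[OF angular_polynomial.zero]) simp
      then have "angular_polynomial 1 (\<lambda>_. c)" by (simp add: angular_monomial_def)
      then show ?thesis by blast
    qed
    show "(\<lambda>x. f x + g x) \<in> {p. \<exists>n. angular_polynomial n p}" if fg: "f \<in> {p. \<exists>n. angular_polynomial n p}" "g \<in> {p. \<exists>n. angular_polynomial n p}" for f g
    proof -
      obtain n m where "angular_polynomial n f" "angular_polynomial m g" using fg by blast
      then have "angular_polynomial (max n m) (\<lambda>x. f x + g x)" by (intro angular_polynomial_add) (auto elim: angular_polynomial_mono)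
      then show ?thesis by blast
    qed
    show "(\<lambda>x. f x * g x) \<in> {p. \<exists>n. angular_polynomial n p}" if "f \<in> {p. \<exists>n. angular_polynomial n p}" "g \<in> {p. \<exists>n. angular_polynomial n p}" for f g
      using that angular_polynomial_mult by blast
    show "\<exists>f\<in>{p. \<exists>n. angular_polynomial n p}. f x \<noteq> f y" if "x \<in> closed_hemisphere" "y \<in> closed_hemisphere" "x \<noteq> y" for x y
    proof -
      \<comment> \<open>On the upper half of the sphere the first two coordinates already separate points.\<close>
      have "angular_monomial 1 0 x \<noteq> angular_monomial 1 0 y \<or> angular_monomial 0 1 x \<noteq> angular_monomial 0 1 y"
        using closed_hemisphere_eqI[OF that(1,2)] that by (auto simp: angular_monomial_def closed_hemisphere_iff)
      moreover have "angular_polynomial 2 (angular_monomial 1 0)" "angular_polynomial 2 (angular_monomial 0 1)" by (auto intro: angular_polynomial_angular_monomial)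
      ultimately show ?thesis by blast
    qed
  qed
  show ?thesis using Stone_Weierstrass_basic[OF assms] that by blast
qed

section \<open>Moments of eigenfunctions\<close>

lemma continuous_on_cutoff_of_triple:
  assumes W: "open W" "punctured_halfspace \<subseteq> W" and f: "continuous_on W f"
  shows "continuous_on half_box (\<lambda>p. cutoff (of_triple p) * f (of_triple p))"
proof -
  have "continuous_on (W \<union> ball 0 1) (\<lambda>x. cutoff x * f x)"
  proof (rule continuous_on_open_Un)
    show "continuous_on W (\<lambda>x. cutoff x * f x)"
      by (intro continuous_intros f continuous_on_subset[OF C1_on_continuous[OF C1_on_cutoff]]) auto
    have "continuous_on (ball 0 1) (\<lambda>x. cutoff x * f x) \<longleftrightarrow> continuous_on (ball 0 1) (\<lambda>x::real^3. 0::real)"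
      by (rule continuous_on_cong) (auto simp: cutoff_eq_0)
    then show "continuous_on (ball 0 1) (\<lambda>x. cutoff x * f x)" by simp
  qed (use W in auto)
  from continuous_on_compose2[OF this continuous_on_of_triple of_triple_half_box_subset[OF W(2)]]
  show ?thesis .
qed

lemma of_triple_half_box_cases: "p \<in> half_box \<Longrightarrow> of_triple p \<in> punctured_halfspace \<or> of_triple p = 0"
  by (cases p) (auto simp: punctured_halfspace_def in_half_box)

text \<open>The factor \<open>\<bar>x\<bar>\<^sup>-\<^sup>2\<close> is the one by which the Laplacian of a function constant along rays differs from the spherical
Laplacian, so that Green's identity becomes the symmetry of the latter for this integral.\<close>

definition shell_integral :: "(real^3 \<Rightarrow> real) \<Rightarrow> real" where
  "shell_integral f = integral half_box (\<lambda>p. cutoff (of_triple p) * ((inverse (norm (of_triple p)))\<^sup>2 * f (of_triple p)))"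

lemma shell_integral_cong:
  assumes "\<And>x. x \<in> punctured_halfspace \<Longrightarrow> f x = g x"
  shows "shell_integral f = shell_integral g"
  unfolding shell_integral_def
proof (rule integral_cong)
  fix p assume "p \<in> half_box"
  then have "of_triple p \<in> punctured_halfspace \<or> of_triple p = 0" by (rule of_triple_half_box_cases)
  then show "cutoff (of_triple p) * ((inverse (norm (of_triple p)))\<^sup>2 * f (of_triple p)) = cutoff (of_triple p) * ((inverse (norm (of_triple p)))\<^sup>2 * g (of_triple p))"
    using assms by (auto simp: cutoff_eq_0)
qed

text \<open>Open neighbourhoods, avoiding the origin, of the closed upper half-space without the origin. Continuity on such a
set makes all shell integrals exist.\<close>

locale shell_domain =
  fixes W :: "(real^3) set"
  assumes open_W: "open W" and zero_W: "0 \<notin> W" and punctured_halfspace_W: "punctured_halfspace \<subseteq> W"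
begin

lemma continuous_shell_integral:
  assumes f: "continuous_on W f"
  shows "continuous_on half_box (\<lambda>p. cutoff (of_triple p) * ((inverse (norm (of_triple p)))\<^sup>2 * f (of_triple p)))"
  using zero_W by (intro continuous_on_cutoff_of_triple[OF open_W punctured_halfspace_W] continuous_intros f) auto

lemma integrable_shell_integral:
  assumes f: "continuous_on W f"
  shows "(\<lambda>p. cutoff (of_triple p) * ((inverse (norm (of_triple p)))\<^sup>2 * f (of_triple p))) integrable_on half_box"
  using continuous_shell_integral[OF f] unfolding half_box_def by (rule integrable_continuous)

lemma shell_integral_lincomb:
  assumes "continuous_on W f" "continuous_on W g"
  shows "shell_integral (\<lambda>x. c * f x + d * g x) = c * shell_integral f + d * shell_integral g"
proof -
  let ?w = "\<lambda>f p. cutoff (of_triple p) * ((inverse (norm (of_triple p)))\<^sup>2 * f (of_triple p))"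
  have "(?w f has_integral shell_integral f) half_box" "(?w g has_integral shell_integral g) half_box"
    using assms[THEN integrable_shell_integral] by (auto simp: shell_integral_def has_integral_integral)
  then have "((\<lambda>p. c * ?w f p + d * ?w g p) has_integral c * shell_integral f + d * shell_integral g) half_box"
    by (intro has_integral_add has_integral_mult_right)
  from integral_unique[OF this] show ?thesis
    by (simp add: shell_integral_def algebra_simps)
qed

lemma shell_integral_mono:
  assumes "continuous_on W f" "continuous_on W g" "\<And>x. x \<in> punctured_halfspace \<Longrightarrow> f x \<le> g x"
  shows "shell_integral f \<le> shell_integral g"
  unfolding shell_integral_def
proof (rule integral_le)
  fix p assume "p \<in> half_box"
  then have "of_triple p \<in> punctured_halfspace \<or> of_triple p = 0" by (rule of_triple_half_box_cases)
  then show "cutoff (of_triple p) * ((inverse (norm (of_triple p)))\<^sup>2 * f (of_triple p)) \<le> cutoff (of_triple p) * ((inverse (norm (of_triple p)))\<^sup>2 * g (of_triple p))"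
  proof
    assume "of_triple p \<in> punctured_halfspace"
    then show ?thesis using assms(3) by (intro mult_left_mono) (auto simp: cutoff_nonneg)
  qed (simp add: cutoff_eq_0)
qed (intro integrable_shell_integral assms)+

lemma shell_integral_eq_0_imp:
  assumes f: "continuous_on W f" and nn: "\<And>x. x \<in> punctured_halfspace \<Longrightarrow> f x \<ge> 0" and 0: "shell_integral f = 0"
    and x: "x \<in> punctured_halfspace" "1 < norm x" "norm x < 2"
  shows "f x = 0"
proof -
  let ?w = "\<lambda>p. cutoff (of_triple p) * ((inverse (norm (of_triple p)))\<^sup>2 * f (of_triple p))"
  have b: "\<bar>x $ i\<bar> < 2" for i using component_le_norm_cart[of x i] x by linarith
  have "?w (x $ 1, x $ 2, x $ 3) = 0"
  proof (rule has_integral_0_cbox_imp_0[of "(-2,-2,0)" "(2,2,2)"])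
    show "continuous_on (cbox (-2,-2,0) (2,2,2)) ?w" using continuous_shell_integral[OF f] by (simp add: half_box_def)
    show "0 \<le> ?w p" if "p \<in> box (-2,-2,0) (2,2,2)" for p
    proof -
      obtain a b c where p: "p = (a, b, c)" by (cases p)
      then have "c > 0" using that by (auto simp: box_def Basis_prod_def)
      then have "of_triple p $ 3 > 0" using p by simp
      then have "of_triple p \<in> punctured_halfspace" by (auto simp: punctured_halfspace_def)
      then show ?thesis using nn by (intro mult_nonneg_nonneg cutoff_nonneg) auto
    qed
    show "(?w has_integral 0) (cbox (-2,-2,0) (2,2,2))"
      using integrable_shell_integral[OF f] 0 by (simp add: shell_integral_def half_box_def has_integral_iff)
    have "(0, 0, 1) \<in> box (-2::real, -2::real, 0::real) (2, 2, 2)" by (auto simp: box_def Basis_prod_def)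
    then show "box (-2::real, -2::real, 0::real) (2, 2, 2) \<noteq> {}" by blast
    have "x $ 3 \<ge> 0" using x by (auto simp: punctured_halfspace_def)
    then show "(x $ 1, x $ 2, x $ 3) \<in> cbox (-2,-2,0) (2,2,2)"
      using b[of 1] b[of 2] b[of 3] in_half_box[of "x $ 1" "x $ 2" "x $ 3"] by (auto simp: half_box_def)
  qed
  moreover have "cutoff x > 0"
  proof -
    have "1 < (norm x)\<^sup>2" using x by (simp add: power2_eq_square) (metis x(2) less_1_mult)
    moreover have "(norm x)\<^sup>2 < 2\<^sup>2" using x by (intro power_strict_mono) auto
    ultimately show ?thesis by (simp add: cutoff_def max_def not_le mult_less_0_iff)
  qed
  ultimately show ?thesis using x by (simp add: of_triple_components punctured_halfspace_def)
qed

end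

text \<open>Apply Green's identity to \<open>G\<close> and an angular monomial: the Laplacian of \<open>G\<close> produces \<open>\<mu>\<close>, and that of the monomial
its triangular expression.\<close>

lemma moment_recursion:
  assumes G: "neumann_field W G" and eig: "\<And>x. x $ 3 > 0 \<Longrightarrow> laplacian G x = - \<mu> * (inverse (norm x))\<^sup>2 * G x"
  shows "(real (a + b) * real (a + b + 1) - \<mu>) * shell_integral (\<lambda>x. G x * angular_monomial a b x)
    = real a * (real a - 1) * shell_integral (\<lambda>x. G x * angular_monomial (a - 2) b x) + real b * (real b - 1) * shell_integral (\<lambda>x. G x * angular_monomial a (b - 2) x)"
proof -
  interpret shell_domain W using G by unfold_locales (auto simp: neumann_field_def)
  have cG: "continuous_on W G" using G by (auto simp: neumann_field_def intro: C1_on_continuous C2_on_imp_C1_on)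
  have cm: "continuous_on W (angular_monomial a b)" for a b
    using neumann_field_angular_monomial[OF open_W zero_W punctured_halfspace_W]
    by (auto simp: neumann_field_def intro: C1_on_continuous C2_on_imp_C1_on)
  have c [simp]: "continuous_on W (\<lambda>x. G x * angular_monomial a b x)" for a b by (intro continuous_intros cG cm)
  define k where "k = real (a + b) * real (a + b + 1) - \<mu>"
  define f where "f x = 1 * (real a * (real a - 1) * (G x * angular_monomial (a - 2) b x) + real b * (real b - 1) * (G x * angular_monomial a (b - 2) x))
       + (- k) * (G x * angular_monomial a b x)" for x
  \<comment> \<open>The eigenvalue equation is only available for \<open>x\<^sub>3 > 0\<close>, hence the passage to the open box.\<close>
  have "shell_integral f = integral (box (-2,-2,0) (2,2,2)) (\<lambda>p. cutoff (of_triple p) * ((inverse (norm (of_triple p)))\<^sup>2 * f (of_triple p)))"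
    unfolding shell_integral_def half_box_def integral_open_interval ..
  also have "\<dots> = integral (box (-2,-2,0) (2,2,2)) (\<lambda>p. cutoff (of_triple p) * (G (of_triple p) * laplacian (angular_monomial a b) (of_triple p) - angular_monomial a b (of_triple p) * laplacian G (of_triple p)))"
  proof (rule integral_cong)
    fix p :: "real \<times> real \<times> real" assume p: "p \<in> box (-2,-2,0) (2,2,2)"
    obtain a' b' c' where p': "p = (a', b', c')" by (cases p)
    then have "c' > 0" using p by (auto simp: box_def Basis_prod_def)
    then have 3: "of_triple p $ 3 > 0" using p' by simp
    then have "of_triple p \<noteq> 0" by auto
    then show "cutoff (of_triple p) * ((inverse (norm (of_triple p)))\<^sup>2 * f (of_triple p)) =
        cutoff (of_triple p) * (G (of_triple p) * laplacian (angular_monomial a b) (of_triple p) - angular_monomial a b (of_triple p) * laplacian G (of_triple p))"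
      unfolding eig[OF 3] laplacian_angular_monomial[OF \<open>of_triple p \<noteq> 0\<close>] by (simp add: f_def k_def algebra_simps)
  qed
  also have "\<dots> = 0"
    using green_half_box[OF G neumann_field_angular_monomial[OF open_W zero_W punctured_halfspace_W], of a b]
    unfolding half_box_def integral_open_interval .
  finally have "shell_integral f = 0" .
  moreover have "shell_integral f = 1 * shell_integral (\<lambda>x. real a * (real a - 1) * (G x * angular_monomial (a - 2) b x) + real b * (real b - 1) * (G x * angular_monomial a (b - 2) x))
     + (- k) * shell_integral (\<lambda>x. G x * angular_monomial a b x)"
    unfolding f_def by (rule shell_integral_lincomb) (intro continuous_intros cG cm)+
  moreover have "shell_integral (\<lambda>x. real a * (real a - 1) * (G x * angular_monomial (a - 2) b x) + real b * (real b - 1) * (G x * angular_monomial a (b - 2) x))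
     = real a * (real a - 1) * shell_integral (\<lambda>x. G x * angular_monomial (a - 2) b x) + real b * (real b - 1) * shell_integral (\<lambda>x. G x * angular_monomial a (b - 2) x)"
    by (rule shell_integral_lincomb) auto
  ultimately show ?thesis unfolding k_def[symmetric] by linarith
qed

text \<open>Induction on the degree. The recursion determines every moment from those of degree lower by two, except in a resonant
degree \<open>n\<close> with \<open>n (n + 1) = \<mu>\<close>.\<close>

lemma moments_eq_0:
  assumes rec: "\<And>a b. (real (a + b) * real (a + b + 1) - \<mu>) * M a b
      = real a * (real a - 1) * M (a - 2) b + real b * (real b - 1) * M a (b - 2)"
    and res: "\<And>a b. real (a + b) * real (a + b + 1) = \<mu> \<Longrightarrow> M a b = (0::real)"
  shows "M a b = 0"
proof (induction "a + b" arbitrary: a b rule: less_induct)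
  case less
  have "real a * (real a - 1) * M (a - 2) b = 0"
  proof (cases "a \<ge> 2")
    case True then show ?thesis using less[of "a - 2" b] by simp
  next
    case False then have "a = 0 \<or> a = 1" by auto
    then show ?thesis by auto
  qed
  moreover have "real b * (real b - 1) * M a (b - 2) = 0"
  proof (cases "b \<ge> 2")
    case True then show ?thesis using less[of a "b - 2"] by simp
  next
    case False then have "b = 0 \<or> b = 1" by auto
    then show ?thesis by auto
  qed
  ultimately have "(real (a + b) * real (a + b + 1) - \<mu>) * M a b = 0" by (simp only: rec add_0_left)
  then show ?case using res[of a b] by (auto simp del: of_nat_add)
qed

text \<open>If \<open>G\<close> is orthogonal to all angular monomials, then it is orthogonal to its own uniform approximations, so the integral
of \<open>G\<^sup>2\<close> is zero.\<close>

lemma moments_determine: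
  assumes G: "neumann_field W G" and Gu: "\<And>x. x \<in> punctured_halfspace \<Longrightarrow> G x = u (x /\<^sub>R norm x)"
    and u: "continuous_on closed_hemisphere u" and 0: "\<And>a b. shell_integral (\<lambda>x. G x * angular_monomial a b x) = 0"
    and x: "x \<in> closed_hemisphere"
  shows "u x = 0"
proof -
  interpret shell_domain W using G by unfold_locales (auto simp: neumann_field_def)
  have cG: "continuous_on W G" using G by (auto simp: neumann_field_def intro: C1_on_continuous C2_on_imp_C1_on)
  have cp: "continuous_on W p" if "angular_polynomial n p" for n p
    using continuous_on_subset[OF C1_on_continuous[OF C2_on_imp_C1_on[OF angular_polynomial_C2_on[OF that]]]] zero_W by auto
  have p0: "shell_integral (\<lambda>x. G x * p x) = 0" if "angular_polynomial n p" for n p using that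
  proof (induction rule: angular_polynomial.induct)
    case zero
    show ?case by (simp add: shell_integral_def)
  next
    case (step p a b c)
    have "shell_integral (\<lambda>x. c * (G x * angular_monomial a b x) + 1 * (G x * p x)) = c * shell_integral (\<lambda>x. G x * angular_monomial a b x) + 1 * shell_integral (\<lambda>x. G x * p x)"
      by (intro shell_integral_lincomb continuous_intros cG cp[OF step(1)] cp[OF angular_polynomial_angular_monomial[OF lessI]])
    then show ?case using 0 step by (simp add: algebra_simps)
  qed
  define C where "C = shell_integral (\<lambda>x. \<bar>G x\<bar>)"
  have C0: "C \<ge> 0" using shell_integral_mono[of "\<lambda>_. 0" "\<lambda>x. \<bar>G x\<bar>"] cG
    by (auto simp: C_def shell_integral_def intro: continuous_intros)
  \<comment> \<open>Replacing one factor of \<open>G\<^sup>2\<close> by a uniform approximation that \<open>G\<close> is orthogonal to costs at most \<open>e C\<close>.\<close>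
  have le: "shell_integral (\<lambda>x. G x * G x) \<le> e * C" if e: "e > 0" for e
  proof -
    obtain n p where p: "angular_polynomial n p" "\<And>x. x \<in> closed_hemisphere \<Longrightarrow> \<bar>u x - p x\<bar> < e"
      using angular_polynomial_dense[OF u e] by metis
    have "shell_integral (\<lambda>x. G x * G x) \<le> shell_integral (\<lambda>x. e * \<bar>G x\<bar> + 1 * (G x * p x))"
    proof (rule shell_integral_mono)
      fix x assume x: "x \<in> punctured_halfspace"
      have "x = norm x *\<^sub>R (x /\<^sub>R norm x)" "norm x > 0" using x by (auto simp: punctured_halfspace_def)
      then have "p x = p (x /\<^sub>R norm x)" using angular_polynomial_scaleR[OF p(1)] by metis
      then have "\<bar>G x - p x\<bar> \<le> e" using p(2)[OF normalize_in_closed_hemisphere[OF x]] Gu[OF x] by simp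
      then have "\<bar>G x\<bar> * \<bar>G x - p x\<bar> \<le> \<bar>G x\<bar> * e" by (intro mult_left_mono) auto
      then have "G x * (G x - p x) \<le> e * \<bar>G x\<bar>" by (simp add: abs_mult[symmetric] mult.commute)
      then show "G x * G x \<le> e * \<bar>G x\<bar> + 1 * (G x * p x)" by (simp add: algebra_simps)
    qed (intro continuous_intros cG cp[OF p(1)])+
    also have "\<dots> = e * C + 1 * shell_integral (\<lambda>x. G x * p x)" unfolding C_def
      by (intro shell_integral_lincomb continuous_intros cG cp[OF p(1)])
    finally show ?thesis using p0[OF p(1)] by simp
  qed
  have "shell_integral (\<lambda>x. G x * G x) \<le> 0"
  proof (rule field_le_epsilon)
    fix e :: real assume e: "e > 0"
    have "shell_integral (\<lambda>x. G x * G x) \<le> e / (C + 1) * C" using e C0 by (intro le) auto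
    also have "\<dots> \<le> 0 + e" using e C0 by (simp add: field_simps)
    finally show "shell_integral (\<lambda>x. G x * G x) \<le> 0 + e" .
  qed
  moreover have "shell_integral (\<lambda>x. G x * G x) \<ge> 0" using shell_integral_mono[of "\<lambda>_. 0" "\<lambda>x. G x * G x"] cG
    by (auto simp: shell_integral_def intro!: continuous_intros)
  ultimately have w0: "shell_integral (\<lambda>x. G x * G x) = 0" by simp
  \<comment> \<open>The weight is positive exactly for radii between 1 and 2, so \<open>u\<close> is read off at radius \<open>3/2\<close>.\<close>
  have x1: "norm x = 1" using x by (simp add: closed_hemisphere_iff)
  then have xu: "(3/2) *\<^sub>R x \<in> punctured_halfspace" using x by (auto simp: punctured_halfspace_def closed_hemisphere_iff)
  have "G ((3/2) *\<^sub>R x) * G ((3/2) *\<^sub>R x) = 0"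
    by (rule shell_integral_eq_0_imp[of "\<lambda>x. G x * G x"]) (use w0 xu x1 in \<open>auto intro!: continuous_intros cG\<close>)
  then show ?thesis using Gu[OF xu] x1 by simp
qed

section \<open>Eigenfunctions with a prescribed leading monomial\<close>

lemma angular_polynomial_laplacian_lincomb:
  assumes "angular_polynomial n p" "angular_polynomial m q" "x \<noteq> 0"
  shows "laplacian (\<lambda>x. c * p x + d * q x) x = c * laplacian p x + d * laplacian q x"
  by (rule laplacian_lincomb[of "- {0}"]) (use assms in \<open>auto intro: angular_polynomial_C2_on\<close>)

lemma laplacian_zero: "laplacian (\<lambda>x. 0) x = 0"
proof -
  have "partial_deriv i (\<lambda>x. 0) = (\<lambda>x. 0)" for i
    using partial_deriv_const[of UNIV] by (auto simp: fun_eq_iff)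
  then show ?thesis by (simp add: laplacian_def)
qed

text \<open>Solves \<open>(\<bar>x\<bar>\<^sup>2 \<Delta> + \<mu>) q = a (a - 1) m\<^sub>a\<^sub>-\<^sub>2\<^sub>,\<^sub>b + b (b - 1) m\<^sub>a\<^sub>,\<^sub>b\<^sub>-\<^sub>2\<close> in lower degree. This is possible because
the diagonal entries \<open>\<mu> - n (n + 1)\<close> of the triangular operator do not vanish for \<open>n < a + b\<close>.\<close>

lemma eigen_correction:
  assumes "\<And>n. n < a + b \<Longrightarrow> real n * (real n + 1) \<noteq> \<mu>"
  shows "\<exists>q. angular_polynomial (a + b) q \<and> (\<forall>x. x \<noteq> 0 \<longrightarrow> laplacian q x = (inverse (norm x))\<^sup>2 *
     (real a * (real a - 1) * angular_monomial (a - 2) b x + real b * (real b - 1) * angular_monomial a (b - 2) x - \<mu> * q x))"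
  using assms
proof (induction "a + b" arbitrary: a b rule: less_induct)
  case less
  \<comment> \<open>Below degree \<open>a + b\<close> the operator is invertible: divide by its diagonal entry \<open>k\<close> and correct recursively.\<close>
  have solve: "\<exists>p. angular_polynomial (a + b) p \<and> (\<forall>x. x \<noteq> 0 \<longrightarrow> laplacian p x = (inverse (norm x))\<^sup>2 * (angular_monomial a' b' x - \<mu> * p x))"
    if lt: "a' + b' < a + b" for a' b'
  proof -
    from less.hyps[OF lt] less.prems lt obtain q where q: "angular_polynomial (a' + b') q"
      "\<And>x. x \<noteq> 0 \<Longrightarrow> laplacian q x = (inverse (norm x))\<^sup>2 *
        (real a' * (real a' - 1) * angular_monomial (a' - 2) b' x + real b' * (real b' - 1) * angular_monomial a' (b' - 2) x - \<mu> * q x)" by force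
    define k where "k = \<mu> - real (a' + b') * real (a' + b' + 1)"
    have k: "k \<noteq> 0" using less.prems[OF lt] by (auto simp: k_def add_ac)
    define p where "p x = inverse k * angular_monomial a' b' x + (- inverse k) * q x" for x
    have "angular_polynomial (a + b) (\<lambda>x. (- inverse k) * q x)" by (rule angular_polynomial_scale[OF angular_polynomial_mono[OF q(1)]]) (use lt in simp)
    then have 1: "angular_polynomial (a + b) p" unfolding p_def by (rule angular_polynomial.step[OF _ lt])
    have "laplacian p x = (inverse (norm x))\<^sup>2 * (angular_monomial a' b' x - \<mu> * p x)" if x: "x \<noteq> 0" for x
    proof -
      have "laplacian p x = inverse k * laplacian (angular_monomial a' b') x + (- inverse k) * laplacian q x"
        unfolding p_def by (rule angular_polynomial_laplacian_lincomb[OF angular_polynomial_angular_monomial[OF lt] q(1) x])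
      also have "\<dots> = (inverse (norm x))\<^sup>2 * (inverse k * ((k - \<mu>) * angular_monomial a' b' x + \<mu> * q x))"
        unfolding laplacian_angular_monomial[OF x] q(2)[OF x] by (simp add: k_def algebra_simps)
      also have "inverse k * ((k - \<mu>) * angular_monomial a' b' x + \<mu> * q x) = angular_monomial a' b' x - \<mu> * p x"
        using k by (simp add: p_def field_simps)
      finally show ?thesis .
    qed
    then show ?thesis using 1 by blast
  qed
  have triv: "angular_polynomial (a + b) (\<lambda>x. 0)" by (rule angular_polynomial.zero)
  have "\<exists>p. angular_polynomial (a + b) p \<and> (\<forall>x. x \<noteq> 0 \<longrightarrow> real a * (real a - 1) * laplacian p x =
      (inverse (norm x))\<^sup>2 * (real a * (real a - 1) * (angular_monomial (a - 2) b x - \<mu> * p x)))"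
  proof (cases "a \<ge> 2")
    case True
    then obtain p where "angular_polynomial (a + b) p" "\<And>x. x \<noteq> 0 \<Longrightarrow> laplacian p x = (inverse (norm x))\<^sup>2 * (angular_monomial (a - 2) b x - \<mu> * p x)"
      using solve[of "a - 2" b] by force
    then show ?thesis by (intro exI[of _ p]) auto
  next
    case False then have "a = 0 \<or> a = 1" by auto
    then show ?thesis using triv by auto
  qed
  then obtain p where p: "angular_polynomial (a + b) p" "\<And>x. x \<noteq> 0 \<Longrightarrow> real a * (real a - 1) * laplacian p x =
      (inverse (norm x))\<^sup>2 * (real a * (real a - 1) * (angular_monomial (a - 2) b x - \<mu> * p x))" by blast
  have "\<exists>p. angular_polynomial (a + b) p \<and> (\<forall>x. x \<noteq> 0 \<longrightarrow> real b * (real b - 1) * laplacian p x =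
      (inverse (norm x))\<^sup>2 * (real b * (real b - 1) * (angular_monomial a (b - 2) x - \<mu> * p x)))"
  proof (cases "b \<ge> 2")
    case True
    then obtain p where "angular_polynomial (a + b) p" "\<And>x. x \<noteq> 0 \<Longrightarrow> laplacian p x = (inverse (norm x))\<^sup>2 * (angular_monomial a (b - 2) x - \<mu> * p x)"
      using solve[of a "b - 2"] by force
    then show ?thesis by (intro exI[of _ p]) auto
  next
    case False then have "b = 0 \<or> b = 1" by auto
    then show ?thesis using triv by auto
  qed
  then obtain p' where p': "angular_polynomial (a + b) p'" "\<And>x. x \<noteq> 0 \<Longrightarrow> real b * (real b - 1) * laplacian p' x =
      (inverse (norm x))\<^sup>2 * (real b * (real b - 1) * (angular_monomial a (b - 2) x - \<mu> * p' x))" by blast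
  define q where "q x = (real a * (real a - 1)) * p x + (real b * (real b - 1)) * p' x" for x
  have "angular_polynomial (a + b) q" unfolding q_def by (intro angular_polynomial_add angular_polynomial_scale p p')
  moreover have "laplacian q x = (inverse (norm x))\<^sup>2 *
     (real a * (real a - 1) * angular_monomial (a - 2) b x + real b * (real b - 1) * angular_monomial a (b - 2) x - \<mu> * q x)" if x: "x \<noteq> 0" for x
  proof -
    have "laplacian q x = (real a * (real a - 1)) * laplacian p x + (real b * (real b - 1)) * laplacian p' x"
      unfolding q_def by (rule angular_polynomial_laplacian_lincomb[OF p(1) p'(1) x])
    then show ?thesis unfolding p(2)[OF x] p'(2)[OF x] by (simp add: q_def algebra_simps)
  qed
  ultimately show ?case by blast
qed

text \<open>With the diagonal entry of degree \<open>a + b\<close> equal to zero, the correction cancels exactly the terms of lower degree. The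
coefficients \<open>1\<close> and \<open>-1\<close> are written out to keep the shape of a linear combination.\<close>

lemma harmonic_with_leading_monomial:
  "\<exists>q. angular_polynomial (a + b) q \<and> (\<forall>x. x \<noteq> 0 \<longrightarrow> laplacian (\<lambda>x. 1 * angular_monomial a b x + (-1) * q x) x =
     - (real (a + b) * (real (a + b) + 1)) * (inverse (norm x))\<^sup>2 * (1 * angular_monomial a b x + (-1) * q x))"
proof -
  define \<mu> where "\<mu> = real (a + b) * (real (a + b) + 1)"
  have "real n * (real n + 1) < \<mu>" if "n < a + b" for n
    unfolding \<mu>_def using that by (intro mult_strict_mono) auto
  then obtain q where q: "angular_polynomial (a + b) q" "\<And>x. x \<noteq> 0 \<Longrightarrow> laplacian q x = (inverse (norm x))\<^sup>2 *
     (real a * (real a - 1) * angular_monomial (a - 2) b x + real b * (real b - 1) * angular_monomial a (b - 2) x - \<mu> * q x)"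
    using eigen_correction[of a b \<mu>] by fastforce
  have "laplacian (\<lambda>x. 1 * angular_monomial a b x + (-1) * q x) x = - \<mu> * (inverse (norm x))\<^sup>2 * (1 * angular_monomial a b x + (-1) * q x)"
    if x: "x \<noteq> 0" for x
  proof -
    have "laplacian (\<lambda>x. 1 * angular_monomial a b x + (-1) * q x) x = 1 * laplacian (angular_monomial a b) x + (-1) * laplacian q x"
      by (rule angular_polynomial_laplacian_lincomb[OF angular_polynomial_angular_monomial[OF lessI] q(1) x])
    then show ?thesis unfolding laplacian_angular_monomial[OF x] q(2)[OF x] by (simp add: \<mu>_def algebra_simps)
  qed
  then show ?thesis using q(1) unfolding \<mu>_def by blast
qed

text \<open>Over a line \<open>x\<^sub>1 = s x\<^sub>2\<close> of the equatorial plane an angular polynomial is a polynomial in one variable, with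
the same bound on the degree.\<close>

lemma angular_polynomial_on_ray:
  assumes "angular_polynomial n p"
  obtains P where "\<And>i. i \<ge> n \<Longrightarrow> coeff P i = 0"
    "\<And>x t. norm x = 1 \<Longrightarrow> x $ 1 = s * t \<Longrightarrow> x $ 2 = t \<Longrightarrow> p x = poly P t"
proof -
  have "\<exists>P. (\<forall>i\<ge>n. coeff P i = 0) \<and> (\<forall>x t. norm x = 1 \<longrightarrow> x $ 1 = s * t \<longrightarrow> x $ 2 = t \<longrightarrow> p x = poly P t)"
    using assms
  proof (induction rule: angular_polynomial.induct)
    case zero
    show ?case by (rule exI[of _ 0]) simp
  next
    case (step p a b c)
    then obtain P where P: "\<And>i. i \<ge> n \<Longrightarrow> coeff P i = 0"
      "\<And>x t. norm x = 1 \<Longrightarrow> x $ 1 = s * t \<Longrightarrow> x $ 2 = t \<Longrightarrow> p x = poly P t" by blast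
    show ?case
      by (rule exI[of _ "monom (c * s ^ a) (a + b) + P"])
        (use step P in \<open>auto simp: poly_monom angular_monomial_def power_add power_mult_distrib\<close>)
  qed
  then show ?thesis using that by blast
qed

text \<open>On the hemisphere above the line \<open>x\<^sub>1 = s x\<^sub>2\<close>, the left side is \<open>(\<Sum>a\<le>l. c\<^sub>a s\<^sup>a) x\<^sub>2\<^sup>l\<close> and the right side is a polynomial in \<open>x\<^sub>2\<close>
of degree below \<open>l\<close>. Hence \<open>\<Sum>a\<le>l. c\<^sub>a s\<^sup>a\<close> is zero for every \<open>s\<close>.\<close>

lemma homogeneous_part_unique:
  assumes q: "angular_polynomial l q" and eq: "\<And>x. x \<in> closed_hemisphere \<Longrightarrow> (\<Sum>a\<le>l. c a * angular_monomial a (l - a) x) = q x" and "a \<le> l"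
  shows "c a = (0::real)"
proof -
  have "poly (\<Sum>a\<le>l. monom (c a) a) s = 0" for s
  proof -
    obtain P where P: "\<And>i. i \<ge> l \<Longrightarrow> coeff P i = 0"
      "\<And>x t. norm x = 1 \<Longrightarrow> x $ 1 = s * t \<Longrightarrow> x $ 2 = t \<Longrightarrow> q x = poly P t" using angular_polynomial_on_ray[OF q] by blast
    define C where "C = (\<Sum>a\<le>l. c a * s ^ a)"
    \<comment> \<open>For \<open>0 < t < r\<close> the point over \<open>(s t, t)\<close> exists on the hemisphere.\<close>
    define r where "r = 1 / (1 + s\<^sup>2)"
    have s0: "1 + s\<^sup>2 > 0" using zero_le_power2[of s] by linarith
    then have r: "0 < r" "r \<le> 1" by (auto simp: r_def)
    have "poly (monom C l - P) t = 0" if t: "t \<in> {0<..<r}" for t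
    proof -
      have "t * t \<le> 1 * t" using t r by (intro mult_right_mono) auto
      also have "\<dots> \<le> r" using t by simp
      finally have "(1 + s\<^sup>2) * t\<^sup>2 \<le> 1" using s0 by (simp add: r_def field_simps power2_eq_square)
      then have le: "(s * t)\<^sup>2 + t\<^sup>2 \<le> 1" by (simp add: algebra_simps power_mult_distrib)
      define x :: "real^3" where "x = vector [s * t, t, sqrt (1 - (s * t)\<^sup>2 - t\<^sup>2)]"
      have x: "x $ 1 = s * t" "x $ 2 = t" "x $ 3 = sqrt (1 - (s * t)\<^sup>2 - t\<^sup>2)" by (simp_all add: x_def)
      have "(norm x)\<^sup>2 = (s * t)\<^sup>2 + t\<^sup>2 + (sqrt (1 - (s * t)\<^sup>2 - t\<^sup>2))\<^sup>2"
        unfolding power2_norm_vec3 x ..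
      also have "\<dots> = 1" using le by simp
      finally have n: "norm x = 1" by (simp add: abs_square_eq_1)
      then have xh: "x \<in> closed_hemisphere" using x le by (simp add: closed_hemisphere_iff)
      have "(\<Sum>a\<le>l. c a * angular_monomial a (l - a) x) = (\<Sum>a\<le>l. c a * s ^ a * t ^ l)"
        by (intro sum.cong) (auto simp: angular_monomial_def n x power_mult_distrib simp flip: power_add)
      also have "\<dots> = C * t ^ l" by (simp add: C_def sum_distrib_right)
      finally show ?thesis using eq[OF xh] P(2)[OF n x(1,2)] by (simp add: poly_monom)
    qed
    then have "{0<..<r} \<subseteq> {t. poly (monom C l - P) t = 0}" by blast
    moreover have "infinite {0<..<r}" using r by (simp add: infinite_Ioo)
    \<comment> \<open>Two polynomials agreeing on an interval coincide; \<open>P\<close> has no term of degree \<open>l\<close>.\<close>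
    ultimately have "monom C l - P = 0" using poly_roots_finite infinite_super by blast
    then have "C = coeff P l" by (metis coeff_monom eq_iff_diff_eq_0)
    then show ?thesis using P(1)[of l] by (simp add: C_def poly_sum poly_monom)
  qed
  then have "(\<Sum>a\<le>l. monom (c a) a) = 0" using poly_all_0_iff_0 by blast
  then have "coeff (\<Sum>a\<le>l. monom (c a) a) a = 0" by simp
  then show ?thesis using \<open>a \<le> l\<close> by (simp add: coeff_sum if_distrib cong: if_cong)
qed

section \<open>The Neumann spectrum of the hemisphere and its multiplicities\<close>

text \<open>The converse of \<open>eigenfunction_extension\<close>, by which eigenspaces are shown to contain linear combinations and
the constructed eigenfunctions.\<close>

lemma neumann_eigenspaceI:
  assumes supp: "\<And>x. x \<notin> closed_hemisphere \<Longrightarrow> u x = 0"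
    and W: "open W" "punctured_halfspace \<subseteq> W" and G: "C2_on W G"
    and Gu: "\<And>x. x \<in> punctured_halfspace \<Longrightarrow> G x = u (x /\<^sub>R norm x)"
    and N: "\<And>p. p \<in> equator \<Longrightarrow> partial_deriv 3 G p = 0"
    and eig: "\<And>x. x \<in> hemisphere \<Longrightarrow> laplacian G x = - \<mu> * G x"
  shows "u \<in> neumann_eigenspace \<mu>"
proof -
  have up: "x \<in> punctured_halfspace" if "x \<in> closed_hemisphere" for x using that by (auto simp: closed_hemisphere_iff punctured_halfspace_def)
  have Gu': "G x = u x" if "x \<in> closed_hemisphere" for x
    using that Gu[OF up[OF that]] by (simp add: closed_hemisphere_iff)
  have "C2_closed_hemisphere u" unfolding C2_closed_hemisphere_def
    using W G Gu' up by blast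
  moreover have "neumann_condition u"
    using neumann_condition_iff[OF W(1) C2_on_imp_C1_on[OF G] _ Gu'] N W(2) up
    by (auto simp: closed_hemisphere_def)
  moreover have "- sphere_laplacian u x = \<mu> * u x" if x: "x \<in> hemisphere" for x
  proof -
    have "laplacian G x = laplacian (\<lambda>y. u (y /\<^sub>R norm y)) x"
    proof (rule laplacian_cong_open)
      show "open {x :: real^3. x $ 3 > 0}" by (rule open_halfspace_component_gt_cart)
      show "x \<in> {x. x $ 3 > 0}" using x by (auto simp: hemisphere_def)
      show "G z = u (z /\<^sub>R norm z)" if "z \<in> {x. x $ 3 > 0}" for z using that by (intro Gu) (auto simp: punctured_halfspace_def)
    qed
    also have "\<dots> = sphere_laplacian u x" by (simp add: laplacian_def sphere_laplacian_def)
    finally show ?thesis using eig[OF x] Gu' x by (simp add: closed_hemisphere_def)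
  qed
  ultimately show ?thesis unfolding neumann_eigenspace_def using supp by blast
qed

lemma neumann_eigenspace_lincomb:
  assumes u: "u \<in> neumann_eigenspace \<mu>" and v: "v \<in> neumann_eigenspace \<mu>"
  shows "(\<lambda>x. c * u x + d * v x) \<in> neumann_eigenspace \<mu>"
proof -
  obtain W1 G1 where 1: "neumann_field W1 G1" "\<And>x. x \<in> punctured_halfspace \<Longrightarrow> G1 x = u (x /\<^sub>R norm x)"
    "\<And>x. x $ 3 > 0 \<Longrightarrow> laplacian G1 x = - \<mu> * (inverse (norm x))\<^sup>2 * G1 x"
    using eigenfunction_extension[OF u] by metis
  obtain W2 G2 where 2: "neumann_field W2 G2" "\<And>x. x \<in> punctured_halfspace \<Longrightarrow> G2 x = v (x /\<^sub>R norm x)"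
    "\<And>x. x $ 3 > 0 \<Longrightarrow> laplacian G2 x = - \<mu> * (inverse (norm x))\<^sup>2 * G2 x"
    using eigenfunction_extension[OF v] by metis
  have W: "open (W1 \<inter> W2)" "punctured_halfspace \<subseteq> W1 \<inter> W2" and C: "C2_on (W1 \<inter> W2) G1" "C2_on (W1 \<inter> W2) G2"
    using 1(1) 2(1) by (auto simp: neumann_field_def intro: C2_on_subset)
  have eqW: "p \<in> W1 \<inter> W2" "p $ 3 = 0" if "p \<in> equator" for p using that W(2) by (auto simp: equator_def punctured_halfspace_def)
  have heW: "p \<in> W1 \<inter> W2" "p $ 3 > 0" "norm p = 1" if "p \<in> hemisphere" for p using that W(2) by (auto simp: hemisphere_def punctured_halfspace_def)
  show ?thesis
  proof (rule neumann_eigenspaceI[OF _ W])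
    show "c * u x + d * v x = 0" if "x \<notin> closed_hemisphere" for x
      using that u v by (auto simp: neumann_eigenspace_def)
    show "C2_on (W1 \<inter> W2) (\<lambda>x. c * G1 x + d * G2 x)"
      by (intro C2_on_add C2_on_mult C2_on_const C W)
    show "partial_deriv 3 (\<lambda>x. c * G1 x + d * G2 x) p = 0" if "p \<in> equator" for p
      using partial_deriv_lincomb[OF W(1) C[THEN C2_on_imp_C1_on] eqW(1)[OF that], of 3 c d] eqW[OF that] 1(1) 2(1)
      by (simp add: neumann_field_def)
    show "laplacian (\<lambda>x. c * G1 x + d * G2 x) x = - \<mu> * (c * G1 x + d * G2 x)" if "x \<in> hemisphere" for x
      using laplacian_lincomb[OF W(1) C heW(1)[OF that], of c d] 1(3) 2(3) heW[OF that] by (simp add: algebra_simps)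
  qed (use 1 2 in auto)
qed

definition restrict_hemisphere :: "(real^3 \<Rightarrow> real) \<Rightarrow> real^3 \<Rightarrow> real" where
  "restrict_hemisphere p x = (if x \<in> closed_hemisphere then p x else 0)"

lemma angular_polynomial_partial_3:
  assumes "angular_polynomial n p" "x \<noteq> 0" "x $ 3 = 0"
  shows "partial_deriv 3 p x = 0"
  using assms(1)
proof (induction rule: angular_polynomial.induct)
  case zero
  show ?case by (rule partial_deriv_const[of UNIV]) auto
next
  case (step p a b c)
  have "partial_deriv 3 (\<lambda>x. c * angular_monomial a b x + 1 * p x) x = c * partial_deriv 3 (angular_monomial a b) x + 1 * partial_deriv 3 p x"
    by (rule partial_deriv_lincomb[of "- {0}"]) (use assms step in \<open>auto intro: C2_on_imp_C1_on C2_on_angular_monomial angular_polynomial_C2_on\<close>)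
  then show ?case using step assms by (simp add: partial_deriv_3_angular_monomial)
qed

lemma restrict_hemisphere_in_eigenspace:
  assumes p: "angular_polynomial n p" and eig: "\<And>x. x \<noteq> 0 \<Longrightarrow> laplacian p x = - \<mu> * (inverse (norm x))\<^sup>2 * p x"
  shows "restrict_hemisphere p \<in> neumann_eigenspace \<mu>"
proof (rule neumann_eigenspaceI[of _ "- {0}" p])
  show "p x = restrict_hemisphere p (x /\<^sub>R norm x)" if "x \<in> punctured_halfspace" for x
    using normalize_in_closed_hemisphere[OF that] angular_polynomial_scaleR[OF p, of "inverse (norm x)" x] that
    by (auto simp: restrict_hemisphere_def punctured_halfspace_def)
  show "partial_deriv 3 p q = 0" if "q \<in> equator" for q
    using that by (intro angular_polynomial_partial_3[OF p]) (auto simp: equator_def)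
  show "laplacian p x = - \<mu> * p x" if "x \<in> hemisphere" for x
    using eig[of x] that by (cases "x = 0") (auto simp: hemisphere_def)
qed (use p in \<open>auto simp: restrict_hemisphere_def punctured_halfspace_def intro: angular_polynomial_C2_on\<close>)

text \<open>Formulated through \<open>u\<close> itself rather than through a chosen extension, so that it is a single functional on the
whole eigenspace.\<close>

definition moment :: "nat \<Rightarrow> nat \<Rightarrow> (real^3 \<Rightarrow> real) \<Rightarrow> real" where
  "moment a b u = shell_integral (\<lambda>x. u (x /\<^sub>R norm x) * angular_monomial a b x)"

lemma moment_eq: "(\<And>x. x \<in> punctured_halfspace \<Longrightarrow> G x = u (x /\<^sub>R norm x)) \<Longrightarrow> moment a b u = shell_integral (\<lambda>x. G x * angular_monomial a b x)"
  unfolding moment_def by (intro shell_integral_cong) simp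

text \<open>An eigenfunction is determined by its moments in the resonant degree. In particular there are no eigenfunctions when there is no
such degree.\<close>

lemma eigenfunction_eq_0:
  assumes u: "u \<in> neumann_eigenspace \<mu>"
    and res: "\<And>a b. real (a + b) * real (a + b + 1) = \<mu> \<Longrightarrow> moment a b u = 0"
  shows "u = (\<lambda>x. 0)"
proof
  fix x
  obtain W G where G: "neumann_field W G" "\<And>x. x \<in> punctured_halfspace \<Longrightarrow> G x = u (x /\<^sub>R norm x)"
    "\<And>x. x $ 3 > 0 \<Longrightarrow> laplacian G x = - \<mu> * (inverse (norm x))\<^sup>2 * G x"
    and c: "continuous_on closed_hemisphere u"
    using eigenfunction_extension[OF u] by metis
  have m0: "shell_integral (\<lambda>x. G x * angular_monomial a b x) = 0" for a b
    by (rule moments_eq_0[where M="\<lambda>a b. shell_integral (\<lambda>x. G x * angular_monomial a b x)", OF moment_recursion[OF G(1,3)]])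
      (use res moment_eq[of G u, OF G(2)] in auto)
  have "u x = 0" if "x \<in> closed_hemisphere"
    by (rule moments_determine[OF G(1,2) c m0 that])
  then show "u x = 0" using u by (cases "x \<in> closed_hemisphere") (auto simp: neumann_eigenspace_def)
qed

lemma moment_lincomb:
  assumes u: "u \<in> neumann_eigenspace \<mu>" and v: "v \<in> neumann_eigenspace \<mu>"
  shows "moment a b (\<lambda>x. c * u x + d * v x) = c * moment a b u + d * moment a b v"
proof -
  obtain W1 G1 where 1: "neumann_field W1 G1" "\<And>x. x \<in> punctured_halfspace \<Longrightarrow> G1 x = u (x /\<^sub>R norm x)"
    using eigenfunction_extension[OF u] by metis
  obtain W2 G2 where 2: "neumann_field W2 G2" "\<And>x. x \<in> punctured_halfspace \<Longrightarrow> G2 x = v (x /\<^sub>R norm x)"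
    using eigenfunction_extension[OF v] by metis
  interpret shell_domain "W1 \<inter> W2" using 1 2 by unfold_locales (auto simp: neumann_field_def)
  have "continuous_on (W1 \<inter> W2) G1" "continuous_on (W1 \<inter> W2) G2"
    using 1(1) 2(1) by (auto simp: neumann_field_def intro: C2_on_subset C1_on_continuous C2_on_imp_C1_on)
  moreover have "continuous_on (W1 \<inter> W2) (angular_monomial a b)"
    using neumann_field_angular_monomial[OF open_W zero_W punctured_halfspace_W]
    by (auto simp: neumann_field_def intro: C1_on_continuous C2_on_imp_C1_on)
  ultimately have "shell_integral (\<lambda>x. c * (G1 x * angular_monomial a b x) + d * (G2 x * angular_monomial a b x))
      = c * shell_integral (\<lambda>x. G1 x * angular_monomial a b x) + d * shell_integral (\<lambda>x. G2 x * angular_monomial a b x)"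
    by (intro shell_integral_lincomb continuous_intros)
  moreover have "moment a b (\<lambda>x. c * u x + d * v x) = shell_integral (\<lambda>x. (c * G1 x + d * G2 x) * angular_monomial a b x)"
    using 1 2 by (intro moment_eq) simp
  ultimately show ?thesis using moment_eq[of G1 u, OF 1(2)] moment_eq[of G2 v, OF 2(2)] by (simp add: algebra_simps)
qed

text \<open>A subspace on which \<open>n\<close> linear functionals separate points has dimension at most \<open>n\<close>. The functionals need to be
linear only on the subspace, as moments are. Each induction step passes to the kernel of one functional, which loses
at most one dimension.\<close>

lemma (in vector_space) span_of_separating_functionals:
  assumes "subspace E"
    and "\<And>i x y. i < n \<Longrightarrow> x \<in> E \<Longrightarrow> y \<in> E \<Longrightarrow> \<phi> i (x + y) = \<phi> i x + \<phi> i y"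
    and "\<And>i c x. i < n \<Longrightarrow> x \<in> E \<Longrightarrow> \<phi> i (scale c x) = c * \<phi> i x"
    and "\<And>x. x \<in> E \<Longrightarrow> (\<And>i. i < n \<Longrightarrow> \<phi> i x = 0) \<Longrightarrow> x = 0"
  shows "\<exists>B. finite B \<and> card B \<le> n \<and> E \<subseteq> span B"
  using assms
proof (induction n arbitrary: E)
  case 0
  then have "E \<subseteq> {0}" by auto
  then show ?case by (intro exI[of _ "{}"]) auto
next
  case (Suc n)
  define K where "K = {x \<in> E. \<phi> n x = 0}"
  have z: "\<phi> n 0 = 0" using Suc.prems(3)[of n 0 0] subspace_0[OF Suc.prems(1)] by simp
  have "subspace K" unfolding K_def
    using Suc.prems(1-3) z by (auto simp: subspace_def)
  then have "\<exists>B. finite B \<and> card B \<le> n \<and> K \<subseteq> span B"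
  proof (rule Suc.IH)
    show "x = 0" if "x \<in> K" "\<And>i. i < n \<Longrightarrow> \<phi> i x = 0" for x
      using that by (intro Suc.prems(4)) (auto simp: K_def less_Suc_eq)
  qed (use Suc.prems(2,3) in \<open>auto simp: K_def\<close>)
  then obtain B where B: "finite B" "card B \<le> n" "K \<subseteq> span B" by blast
  show ?case
  proof (cases "E = K")
    case True
    then show ?thesis using B by (intro exI[of _ B]) auto
  next
    case False
    then obtain e where e: "e \<in> E" "\<phi> n e \<noteq> 0" by (auto simp: K_def)
    have "x \<in> span (insert e B)" if x: "x \<in> E" for x
    proof -
      \<comment> \<open>Subtracting the right multiple of \<open>e\<close> moves \<open>x\<close> into the kernel of the last functional.\<close>
      define k where "k = - (\<phi> n x / \<phi> n e)"
      have ke: "scale k e \<in> E" using Suc.prems(1) e by (simp add: subspace_scale)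
      have "\<phi> n (x + scale k e) = \<phi> n x + k * \<phi> n e"
        using Suc.prems(2)[OF lessI x ke] Suc.prems(3)[OF lessI e(1)] by simp
      then have "x + scale k e \<in> K" unfolding K_def
        using subspace_add[OF Suc.prems(1) x ke] e(2) by (simp add: k_def)
      then have "x + scale k e \<in> span (insert e B)" using B(3) span_mono[of B "insert e B"] by auto
      moreover have "scale k e \<in> span (insert e B)" by (intro span_scale span_base) simp
      ultimately have "(x + scale k e) - scale k e \<in> span (insert e B)" by (rule span_diff)
      then show ?thesis by simp
    qed
    then show ?thesis using B by (intro exI[of _ "insert e B"]) (auto simp: card_insert_if)
  qed
qed

interpretation function_space: vector_space fun_scale by (rule vector_space_fun_scale)

lemma subspace_neumann_eigenspace: "function_space.subspace (neumann_eigenspace \<mu>)"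
proof (rule function_space.subspaceI)
  have "restrict_hemisphere (\<lambda>x. 0) \<in> neumann_eigenspace \<mu>"
    by (rule restrict_hemisphere_in_eigenspace[OF angular_polynomial.zero]) (simp add: laplacian_zero)
  then show "0 \<in> neumann_eigenspace \<mu>" by (simp add: restrict_hemisphere_def[abs_def] zero_fun_def)
  show "u + v \<in> neumann_eigenspace \<mu>" if "u \<in> neumann_eigenspace \<mu>" "v \<in> neumann_eigenspace \<mu>" for u v
    using neumann_eigenspace_lincomb[OF that, of 1 1] by (simp add: plus_fun_def)
  show "fun_scale c u \<in> neumann_eigenspace \<mu>" if "u \<in> neumann_eigenspace \<mu>" for c u
    using neumann_eigenspace_lincomb[OF that that, of c 0] by (simp add: fun_scale_def)
qed

lemma neumann_eigenspace_spanned: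
  assumes mu: "\<mu> = real l * (real l + 1)"
  shows "\<exists>B. finite B \<and> card B \<le> l + 1 \<and> neumann_eigenspace \<mu> \<subseteq> function_space.span B"
proof (rule function_space.span_of_separating_functionals[OF subspace_neumann_eigenspace, where \<phi>="\<lambda>a. moment a (l - a)"])
  show "moment a (l - a) (u + v) = moment a (l - a) u + moment a (l - a) v"
    if "u \<in> neumann_eigenspace \<mu>" "v \<in> neumann_eigenspace \<mu>" for a u v
    using moment_lincomb[OF that, of a "l - a" 1 1] by (simp add: plus_fun_def)
  show "moment a (l - a) (fun_scale c u) = c * moment a (l - a) u"
    if "u \<in> neumann_eigenspace \<mu>" for a c u
    using moment_lincomb[OF that that, of a "l - a" c 0] by (simp add: fun_scale_def)
  show "u = 0" if u: "u \<in> neumann_eigenspace \<mu>" and 0: "\<And>a. a < l + 1 \<Longrightarrow> moment a (l - a) u = 0" for u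
  proof -
    have "moment a b u = 0" if "real (a + b) * real (a + b + 1) = \<mu>" for a b
    proof -
      have "(a + b) * (a + b + 1) = l * (l + 1)"
        using that unfolding mu by (metis of_nat_Suc of_nat_eq_iff of_nat_mult Suc_eq_plus1 add.commute)
      moreover have "strict_mono (\<lambda>n::nat. n * (n + 1))" by (rule strict_monoI) (intro mult_strict_mono, auto)
      ultimately have "a + b = l" by (metis (mono_tags, lifting) strict_mono_eq)
      then show ?thesis using 0[of a] by auto
    qed
    from eigenfunction_eq_0[OF u this] show ?thesis by (simp add: zero_fun_def)
  qed
qed

text \<open>One eigenfunction for each of the \<open>l + 1\<close> monomials of degree \<open>l\<close>. A linear relation between them expresses a
combination of these monomials by lower terms, which forces the coefficients to be zero.\<close>

lemma independent_eigenfunctions: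
  assumes mu: "\<mu> = real l * (real l + 1)"
  shows "\<exists>S. S \<subseteq> neumann_eigenspace \<mu> \<and> function_space.independent S \<and> card S = l + 1"
proof -
  have "\<exists>q. angular_polynomial l q \<and> restrict_hemisphere (\<lambda>x. 1 * angular_monomial a (l - a) x + (-1) * q x) \<in> neumann_eigenspace \<mu>" if "a \<le> l" for a
  proof -
    have l: "a + (l - a) = l" using that by simp
    obtain q where q: "angular_polynomial l q" and eig: "\<And>x. x \<noteq> 0 \<Longrightarrow> laplacian (\<lambda>x. 1 * angular_monomial a (l - a) x + (-1) * q x) x =
     - \<mu> * (inverse (norm x))\<^sup>2 * (1 * angular_monomial a (l - a) x + (-1) * q x)"
      using harmonic_with_leading_monomial[of a "l - a"] unfolding l mu[symmetric] by blast
    have "angular_polynomial (Suc l) (\<lambda>x. 1 * angular_monomial a (l - a) x + (-1) * q x)"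
      by (rule angular_polynomial.step[OF angular_polynomial_scale[OF angular_polynomial_mono[OF q]]]) (use that in auto)
    from restrict_hemisphere_in_eigenspace[OF this eig] q show ?thesis by blast
  qed
  then obtain q where q: "\<And>a. a \<le> l \<Longrightarrow> angular_polynomial l (q a)"
    and e: "\<And>a. a \<le> l \<Longrightarrow> restrict_hemisphere (\<lambda>x. 1 * angular_monomial a (l - a) x + (-1) * q a x) \<in> neumann_eigenspace \<mu>"
    by metis
  define h where "h a = restrict_hemisphere (\<lambda>x. 1 * angular_monomial a (l - a) x + (-1) * q a x)" for a
  have ind: "c a = 0" if "(\<Sum>a\<le>l. fun_scale (c a) (h a)) = 0" "a \<le> l" for c a
  proof (rule homogeneous_part_unique[where q="\<lambda>x. \<Sum>a\<le>l. c a * q a x" and l=l])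
    have "angular_polynomial l (\<lambda>x. \<Sum>a\<in>A. c a * q a x)" if "finite A" "A \<subseteq> {..l}" for A
      using that by (induction A) (auto intro!: angular_polynomial.zero angular_polynomial_add angular_polynomial_scale q)
    then show "angular_polynomial l (\<lambda>x. \<Sum>a\<le>l. c a * q a x)" by simp
    have sum_app: "(\<Sum>a\<in>A. F a) x = (\<Sum>a\<in>A. F a x)" for F :: "nat \<Rightarrow> real^3 \<Rightarrow> real" and A x
      by (induction A rule: infinite_finite_induct) auto
    show "(\<Sum>a\<le>l. c a * angular_monomial a (l - a) x) = (\<Sum>a\<le>l. c a * q a x)" if x: "x \<in> closed_hemisphere" for x
    proof -
      have "(\<Sum>a\<le>l. fun_scale (c a) (h a)) x = 0" using \<open>(\<Sum>a\<le>l. fun_scale (c a) (h a)) = 0\<close> by simp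
      then have "(\<Sum>a\<le>l. c a * (angular_monomial a (l - a) x - q a x)) = 0"
        using x by (simp add: sum_app fun_scale_def h_def restrict_hemisphere_def)
      then show ?thesis by (simp add: algebra_simps sum_subtractf)
    qed
  qed fact
  have inj: "inj_on h {..l}"
  proof (rule inj_onI, rule ccontr)
    fix a b assume ab: "a \<in> {..l}" "b \<in> {..l}" "h a = h b" "a \<noteq> b"
    \<comment> \<open>Equal functions at two indices would give the nontrivial relation \<open>h a - h b = 0\<close>.\<close>
    define c where "c i = (if i = a then 1 else if i = b then -1 else 0 :: real)" for i
    have "(\<Sum>i\<le>l. fun_scale (c i) (h i)) = (\<Sum>i\<in>{a,b}. fun_scale (c i) (h i))"
      by (rule sum.mono_neutral_right) (use ab in \<open>auto simp: c_def\<close>)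
    also have "\<dots> = 0" using ab by (auto simp: c_def fun_scale_def fun_eq_iff)
    finally have "c a = 0" using ind[of c a] ab by simp
    then show False by (simp add: c_def)
  qed
  have "function_space.independent (h ` {..l})"
  proof (rule function_space.independent_if_scalars_zero)
    fix f x assume "(\<Sum>x\<in>h ` {..l}. fun_scale (f x) x) = 0" "x \<in> h ` {..l}"
    then show "f x = 0" using ind[of "\<lambda>a. f (h a)"] by (auto simp: sum.reindex[OF inj])
  qed simp
  moreover have "card (h ` {..l}) = l + 1" by (simp add: card_image inj)
  moreover have "h ` {..l} \<subseteq> neumann_eigenspace \<mu>" using e by (auto simp: h_def)
  ultimately show ?thesis by blast
qed

lemma neumann_multiplicity_eq:
  assumes mu: "\<mu> = real l * (real l + 1)"
  shows "neumann_multiplicity \<mu> = l + 1"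
proof -
  obtain B where B: "finite B" "card B \<le> l + 1" "neumann_eigenspace \<mu> \<subseteq> function_space.span B"
    using neumann_eigenspace_spanned[OF mu] by blast
  obtain S where S: "S \<subseteq> neumann_eigenspace \<mu>" "function_space.independent S" "card S = l + 1"
    using independent_eigenfunctions[OF mu] by blast
  obtain T where T: "T \<subseteq> neumann_eigenspace \<mu>" "function_space.independent T" "neumann_eigenspace \<mu> \<subseteq> function_space.span T"
    "card T = function_space.dim (neumann_eigenspace \<mu>)"
    using function_space.basis_exists by blast
  have "finite T" "card T \<le> card B" using function_space.independent_span_bound[OF B(1) T(2)] T(1) B(3) by auto
  moreover have "card S \<le> card T" using function_space.independent_span_bound[OF \<open>finite T\<close> S(2)] S(1) T(3) by auto
  ultimately show ?thesis using B(2) S(3) T(4) by (simp add: neumann_multiplicity_def)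
qed

lemma neumann_eigenvalues_eq: "neumann_eigenvalues = range (\<lambda>l::nat. real l * (real l + 1))"
proof (intro equalityI subsetI)
  fix \<mu> assume "\<mu> \<in> neumann_eigenvalues"
  then obtain u where u: "u \<in> neumann_eigenspace \<mu>" "u \<noteq> (\<lambda>x. 0)" by (auto simp: neumann_eigenvalues_def)
  then obtain a b where "real (a + b) * real (a + b + 1) = \<mu>" using eigenfunction_eq_0[OF u(1)] by metis
  then show "\<mu> \<in> range (\<lambda>l::nat. real l * (real l + 1))" by (intro image_eqI[of _ _ "a + b"]) (auto simp: algebra_simps)
next
  fix \<mu> assume "\<mu> \<in> range (\<lambda>l::nat. real l * (real l + 1))"
  then obtain l :: nat where mu: "\<mu> = real l * (real l + 1)" by auto
  obtain S where S: "S \<subseteq> neumann_eigenspace \<mu>" "function_space.independent S" "card S = l + 1"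
    using independent_eigenfunctions[OF mu] by blast
  then obtain u where "u \<in> S" by fastforce
  moreover have "u \<noteq> 0" using \<open>u \<in> S\<close> S(2) function_space.dependent_zero by blast
  ultimately show "\<mu> \<in> neumann_eigenvalues" using S(1) by (auto simp: neumann_eigenvalues_def zero_fun_def)
qed

lemma neumann_riesz_mean_eq:
  "neumann_riesz_mean z = (\<Sum>\<^sub>\<infinity>l. (real l + 1) * max (z - real l * (real l + 1)) 0)"
proof -
  have "strict_mono (\<lambda>l::nat. real l * (real l + 1))" by (rule strict_monoI) (intro mult_strict_mono, auto)
  then have inj: "inj (\<lambda>l::nat. real l * (real l + 1))" by (rule strict_mono_imp_inj_on)
  have m: "real (neumann_multiplicity (real l * (real l + 1))) = real l + 1" for l
    using neumann_multiplicity_eq[of "real l * (real l + 1)" l] by simp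
  show ?thesis
    by (simp only: neumann_riesz_mean_def neumann_eigenvalues_eq infsum_reindex[OF inj] o_def m)
qed

section \<open>Riesz means of the sequence of eigenvalues\<close>

lemma riesz_partial_sum:
  "(\<Sum>l\<le>L. (real l + 1) * (z - real l * (real l + 1))) =
     z * (real L + 1) * (real L + 2) / 2 - real L * (real L + 1) * (real L + 2) * (3 * real L + 5) / 12"
  by (induction L) (auto simp: field_simps)

text \<open>Here \<open>z = s\<^sup>2 - 1/4\<close> with \<open>s = L + 1/2 + t\<close>, so both sides are polynomials in \<open>L\<close> and \<open>t\<close>. The factors \<open>t\<close> and \<open>1 - t\<close>
reflect that the lower bound is attained at two consecutive eigenvalues.\<close>

lemma riesz_defect:
  fixes L t z :: real
  assumes "z = (L + t) * (L + 1 + t)"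
  shows "z * (L + 1) * (L + 2) / 2 - L * (L + 1) * (L + 2) * (3 * L + 5) / 12
      - (z\<^sup>2 / 4 + z * (L + 1 / 2 + t) / 3)
    = t * (1 - t) * ((L + 1) * (L + 1 + t) + t\<^sup>2 / 4 + t / 12 - 1 / 6)"
  unfolding assms by (simp add: field_simps power2_eq_square)

text \<open>The last factor is positive because \<open>(L + 1) (L + 1 + t) \<ge> 1\<close>. For the upper bound, \<open>z - D\<close> is a sum of nonnegative
terms and \<open>t\<^sup>2 + t\<^sup>3\<close>, minus \<open>t (1 - t) (t\<^sup>2/4 + t/12 - 1/6)\<close>, which is at most \<open>t\<^sup>3/4 + t\<^sup>2/12\<close>.\<close>

lemma riesz_bounds:
  fixes L t z :: real
  assumes z: "z = (L + t) * (L + 1 + t)" and "L \<ge> 0" "0 \<le> t" "t < 1"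
  defines "D \<equiv> t * (1 - t) * ((L + 1) * (L + 1 + t) + t\<^sup>2 / 4 + t / 12 - 1 / 6)"
  shows "0 \<le> D" "D \<le> z" "D = 0 \<longleftrightarrow> t = 0"
proof -
  have "1 * 1 \<le> (L + 1) * (L + 1 + t)" using assms by (intro mult_mono) auto
  then have Q: "(L + 1) * (L + 1 + t) + t\<^sup>2 / 4 + t / 12 - 1 / 6 > 0"
    using assms(3) zero_le_power2[of t] by linarith
  show "0 \<le> D" unfolding D_def using assms Q by (intro mult_nonneg_nonneg) auto
  show "D = 0 \<longleftrightarrow> t = 0" unfolding D_def using assms Q by auto
  have "z - D = (L + 1 + t) * (L * ((1 - t) + t\<^sup>2)) + (L * t\<^sup>2 + t\<^sup>2 + t ^ 3) - t * (1 - t) * (t\<^sup>2 / 4 + t / 12 - 1 / 6)"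
    unfolding D_def z by (simp add: field_simps power2_eq_square power3_eq_cube)
  moreover have "0 \<le> (L + 1 + t) * (L * ((1 - t) + t\<^sup>2))" "0 \<le> L * t\<^sup>2"
    using assms by (auto intro!: mult_nonneg_nonneg add_nonneg_nonneg)
  moreover have "t * (1 - t) * (t\<^sup>2 / 4 + t / 12 - 1 / 6) \<le> t * 1 * (t\<^sup>2 / 4 + t / 12)"
  proof -
    have "t * (1 - t) * (t\<^sup>2 / 4 + t / 12 - 1 / 6) \<le> t * (1 - t) * (t\<^sup>2 / 4 + t / 12)"
      using assms by (intro mult_left_mono) auto
    also have "\<dots> \<le> t * 1 * (t\<^sup>2 / 4 + t / 12)"
      using assms by (intro mult_right_mono mult_left_mono) auto
    finally show ?thesis .
  qed
  moreover have "t * 1 * (t\<^sup>2 / 4 + t / 12) = t ^ 3 / 4 + t\<^sup>2 / 12"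
    by (simp add: field_simps power2_eq_square power3_eq_cube)
  moreover have "0 \<le> t ^ 3" using assms by simp
  ultimately show "D \<le> z" using zero_le_power2[of t] by linarith
qed

lemma riesz_sum_bounds:
  fixes z R :: real
  assumes z0: "z \<ge> 0" and R: "R = (\<Sum>\<^sub>\<infinity>l. (real l + 1) * max (z - real l * (real l + 1)) 0)"
  shows "z\<^sup>2 / 4 + z * sqrt (z + 1 / 4) / 3 \<le> R
       \<and> R \<le> z\<^sup>2 / 4 + z * sqrt (z + 1 / 4) / 3 + z
       \<and> (R = z\<^sup>2 / 4 + z * sqrt (z + 1 / 4) / 3 \<longleftrightarrow> (\<exists>l::nat. z = real l * (real l + 1)))"
proof -
  define s where "s = sqrt (z + 1 / 4)"
  have s2: "s\<^sup>2 = z + 1 / 4" using z0 by (simp add: s_def)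
  have s_half: "s \<ge> 1 / 2" unfolding s_def using z0 by (intro real_le_rsqrt) (auto simp: power2_eq_square)
  \<comment> \<open>The eigenvalues not exceeding \<open>z\<close> are those of index at most \<open>L\<close>, and \<open>t\<close> measures the position of \<open>z\<close> between the consecutive levels \<open>L (L + 1)\<close> and \<open>(L + 1) (L + 2)\<close>.\<close>
  define L where "L = nat \<lfloor>s - 1 / 2\<rfloor>"
  define t where "t = s - 1 / 2 - real L"
  have L: "real L = of_int \<lfloor>s - 1 / 2\<rfloor>" unfolding L_def using s_half by simp
  have t: "0 \<le> t" "t < 1" unfolding t_def L by linarith+
  have zt: "z = (real L + t) * (real L + 1 + t)"
    using s2 unfolding t_def by (simp add: field_simps power2_eq_square)
  have le: "real l * (real l + 1) \<le> z" if "l \<le> L" for l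
    unfolding zt using that t by (intro mult_mono) auto
  have ge: "z \<le> real l * (real l + 1)" if "l > L" for l
    unfolding zt using that t by (intro mult_mono) auto
  have "R = (\<Sum>\<^sub>\<infinity>l\<in>{..L}. (real l + 1) * max (z - real l * (real l + 1)) 0)"
    unfolding R using ge by (intro infsum_cong_neutral) (auto simp: max_def not_le intro: antisym)
  also have "\<dots> = (\<Sum>l\<le>L. (real l + 1) * (z - real l * (real l + 1)))"
    using le by (auto intro!: sum.cong simp: max_absorb1)
  finally have R': "R - (z\<^sup>2 / 4 + z * s / 3) =
    t * (1 - t) * ((real L + 1) * (real L + 1 + t) + t\<^sup>2 / 4 + t / 12 - 1 / 6)"
    using riesz_defect[OF zt] unfolding riesz_partial_sum by (simp add: t_def)
  note b = riesz_bounds[OF zt _ t, simplified, folded R']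
  have "t = 0 \<longleftrightarrow> (\<exists>l::nat. z = real l * (real l + 1))"
  proof
    assume "t = 0" then show "\<exists>l::nat. z = real l * (real l + 1)" using zt by auto
  next
    assume "\<exists>l::nat. z = real l * (real l + 1)"
    then obtain l :: nat where l: "z = real l * (real l + 1)" by auto
    then have "s = real l + 1 / 2" unfolding s_def
      by (intro real_sqrt_unique) (auto simp: field_simps power2_eq_square)
    then show "t = 0" by (simp add: t_def L_def)
  qed
  then show ?thesis using b R' riesz_bounds(3)[OF zt _ t, folded R']
    unfolding s_def[symmetric] by (auto simp: algebra_simps)
qed

theorem theorem3p2p3:
  fixes z :: real
  assumes "z \<ge> 0"
  shows "z\<^sup>2 / 4 + z * sqrt (z + 1 / 4) / 3 \<le> neumann_riesz_mean z
       \<and> neumann_riesz_mean z \<le> z\<^sup>2 / 4 + z * sqrt (z + 1 / 4) / 3 + z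
       \<and> (neumann_riesz_mean z = z\<^sup>2 / 4 + z * sqrt (z + 1 / 4) / 3
            \<longleftrightarrow> (\<exists>l::nat. z = real l * (real l + 1)))"
  using riesz_sum_bounds[OF assms neumann_riesz_mean_eq] .

end
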